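(* Let $n\ge 2$, $a_1,\ldots,a_{n-1}$ nonnegative integers and $\lambda=\sum a_i\omega_i$. For every $w\in S_n$ the point $T_w$ is a vertex of $P_\lambda$. Moreover, $\{T_w: w\in S_n\}=\{x(E): E\in\mathbf R_p\}$, where $\mathbf R_p$ is the set of all $E\subset R$ such that for any two segments in $E$ with nonempty intersection, this intersection belongs to $E$.
   Context: Let $U=\mathbb R^{\binom n2}$ with coordinates $x_{i,j}$, $1\le i<j\le n$. A Dyck path is a sequence $d=((i_1,j_1),\ldots,(i_N,j_N))$ of pairs with $1\le i_k<j_k\le n$, $j_1-i_1=j_N-i_N=1$, and each $(i_{k+1},j_{k+1})$ equal to $(i_k+1,j_k)$ or $(i_k,j_k+1)$. Put $S(x,d)=\sum_{(i,j)\in d}x_{i,j}$ and $M(\lambda,d)=a_{i_1}+a_{i_1+1}+\ldots+a_{i_N}$. The FFLV polytope is $P_\lambda=\{x\in U: x\ge 0,\ S(x,d)\le M(\lambda,d)\ \forall d\}$ and $\Pi_\lambda=P_\lambda\cap\mathbb Z^{\binom n2}$. Let $\alpha_1,\ldots,\alpha_{n-1}$ be the simple roots of $\mathfrak{sl}_n$, $\alpha_{i,j}=\alpha_i+\ldots+\alpha_{j-1}$, $\varepsilon_i=\omega_i-\omega_{i-1}$ ($\omega_0=\omega_n=0$); the Weyl group $S_n$ acts on weights by $w\varepsilon_i=\varepsilon_{w(i)}$. For $T\in\Pi_\lambda$ let $\mu_T=\lambda-\sum_{i<j}T_{i,j}\alpha_{i,j}$ (the weight of the FFLV basis vector $v_T$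 in the irreducible module $L_\lambda$); for every $w\in S_n$ there is a unique $T_w\in\Pi_\lambda$ with $\mu_{T_w}=w\lambda$. Let $R$ be the set of segments $[i,j]$ with integers $1\le i<j\le n$. For $i<j$ let $d^{i,j}=((i,i+1),(i,i+2),\ldots,(i,j),(i+1,j),\ldots,(j-1,j))$. For $E\subset R$, $x(E)\in U$ is the unique point with $x(E)_{i,j}=0$ if $[i,j]\notin E$ and $S(x(E),d^{i,j})=a_i+\ldots+a_{j-1}$ if $[i,j]\in E$. *)

theory Defs
  imports
    "HOL-Analysis.Analysis"
    "HOL-Analysis.Finite_Function_Topology"
    "HOL-Combinatorics.Permutations"
begin

section \<open>The FFLV polytope\<close>

text \<open>
  Points of \<open>U\<close> are finitely supported functions on pairs of naturals whose support is contained in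
  \<open>pairs n\<close>. The type of finitely supported functions is a real vector space, so that \<open>U n\<close> is a
  linear subspace of dimension \<open>n choose 2\<close> and the library's notion of extreme point applies.
\<close>

type_synonym point = "(nat \<times> nat) \<Rightarrow>\<^sub>0 real"

definition pairs :: "nat \<Rightarrow> (nat \<times> nat) set" where
  "pairs n = {(i, j). 1 \<le> i \<and> i < j \<and> j \<le> n}"

definition U :: "nat \<Rightarrow> point set" where
  "U n = {x. Poly_Mapping.keys x \<subseteq> pairs n}"

definition dyck_path :: "nat \<Rightarrow> (nat \<times> nat) list \<Rightarrow> bool" where
  "dyck_path n d \<longleftrightarrow>
     d \<noteq> [] \<and> set d \<subseteq> pairs n \<and>
     snd (hd d) = fst (hd d) + 1 \<and> snd (last d) = fst (last d) + 1 \<and>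
     (\<forall>k. k + 1 < length d \<longrightarrow>
        d ! (k + 1) = (fst (d ! k) + 1, snd (d ! k)) \<or>
        d ! (k + 1) = (fst (d ! k), snd (d ! k) + 1))"

definition S :: "point \<Rightarrow> (nat \<times> nat) list \<Rightarrow> real" where
  "S x d = (\<Sum>p\<leftarrow>d. Poly_Mapping.lookup x p)"

definition M :: "(nat \<Rightarrow> nat) \<Rightarrow> (nat \<times> nat) list \<Rightarrow> real" where
  "M a d = (\<Sum>k = fst (hd d)..fst (last d). real (a k))"

definition FFLV_polytope :: "nat \<Rightarrow> (nat \<Rightarrow> nat) \<Rightarrow> point set" where
  "FFLV_polytope n a =
     {x \<in> U n. (\<forall>p \<in> pairs n. 0 \<le> Poly_Mapping.lookup x p) \<and>
               (\<forall>d. dyck_path n d \<longrightarrow> S x d \<le> M a d)}"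

definition FFLV_lattice_points :: "nat \<Rightarrow> (nat \<Rightarrow> nat) \<Rightarrow> point set" where
  "FFLV_lattice_points n a =
     {x \<in> FFLV_polytope n a. \<forall>p \<in> pairs n. Poly_Mapping.lookup x p \<in> \<int>}"

section \<open>Weights of \<open>sl\<^sub>n\<close>\<close>

text \<open>
  A weight is given by its coordinates with respect to the basis of fundamental weights
  \<open>\<omega>\<^sub>1, \<dots>, \<omega>\<^bsub>n-1\<^esub>\<close>. The simple roots are \<open>\<alpha>\<^sub>i = \<epsilon>\<^sub>i - \<epsilon>\<^bsub>i+1\<^esub> = 2\<omega>\<^sub>i - \<omega>\<^bsub>i-1\<^esub> - \<omega>\<^bsub>i+1\<^esub>\<close>.
\<close>

type_synonym weight = "nat \<Rightarrow>\<^sub>0 real"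

definition fund_weight :: "nat \<Rightarrow> nat \<Rightarrow> weight" where
  "fund_weight n i = (if 1 \<le> i \<and> i < n then Poly_Mapping.single i 1 else 0)"

definition eps :: "nat \<Rightarrow> nat \<Rightarrow> weight" where
  "eps n i = fund_weight n i - fund_weight n (i - 1)"

definition simple_root :: "nat \<Rightarrow> nat \<Rightarrow> weight" where
  "simple_root n i = eps n i - eps n (i + 1)"

definition pos_root :: "nat \<Rightarrow> nat \<Rightarrow> nat \<Rightarrow> weight" where
  "pos_root n i j = (\<Sum>k = i..<j. simple_root n k)"

definition highest_weight :: "nat \<Rightarrow> (nat \<Rightarrow> nat) \<Rightarrow> weight" where
  "highest_weight n a = (\<Sum>i = 1..<n. real (a i) *\<^sub>R fund_weight n i)"

text \<open>
  Since \<open>\<omega>\<^sub>k = \<epsilon>\<^sub>1 + \<dots> + \<epsilon>\<^sub>k\<close>, the weight \<open>\<Sum>\<^sub>k c\<^sub>k \<omega>\<^sub>k\<close> equals \<open>\<Sum>\<^sub>i (\<Sum>\<^bsub>k\<ge>i\<^esub> c\<^sub>k) \<epsilon>\<^sub>i\<close>. The lemmas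
  \<open>linear_weyl_act\<close> and \<open>weyl_act_eps\<close> below show that the following is the linear action
  determined by \<open>w \<epsilon>\<^sub>i = \<epsilon>\<^bsub>w(i)\<^esub>\<close>.
\<close>

definition weyl_act :: "nat \<Rightarrow> (nat \<Rightarrow> nat) \<Rightarrow> weight \<Rightarrow> weight" where
  "weyl_act n w \<mu> = (\<Sum>i = 1..n. (\<Sum>k = i..<n. Poly_Mapping.lookup \<mu> k) *\<^sub>R eps n (w i))"

definition point_weight :: "nat \<Rightarrow> (nat \<Rightarrow> nat) \<Rightarrow> point \<Rightarrow> weight" where
  "point_weight n a T =
     highest_weight n a - (\<Sum>(i, j) \<in> pairs n. Poly_Mapping.lookup T (i, j) *\<^sub>R pos_root n i j)"

definition extremal_point :: "nat \<Rightarrow> (nat \<Rightarrow> nat) \<Rightarrow> (nat \<Rightarrow> nat) \<Rightarrow> point" where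
  "extremal_point n a w =
     (THE T. T \<in> FFLV_lattice_points n a \<and> point_weight n a T = weyl_act n w (highest_weight n a))"

section \<open>Sets of segments\<close>

text \<open>
  A segment \<open>[i, j]\<close> is the set \<open>{i..j}\<close> of naturals. Two segments sharing exactly one endpoint
  have a nonempty intersection that is not a segment of \<open>segments n\<close>; hence no member of \<open>Rp n\<close>
  contains two such segments.
\<close>

definition segments :: "nat \<Rightarrow> nat set set" where
  "segments n = {{i..j} | i j. 1 \<le> i \<and> i < j \<and> j \<le> n}"

definition Rp :: "nat \<Rightarrow> nat set set set" where
  "Rp n = {E. E \<subseteq> segments n \<and> (\<forall>s \<in> E. \<forall>t \<in> E. s \<inter> t \<noteq> {} \<longrightarrow> s \<inter> t \<in> E)}"

definition corner_path :: "nat \<Rightarrow> nat \<Rightarrow> (nat \<times> nat) list" where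
  "corner_path i j = map (\<lambda>k. (i, k)) [i+1..<j+1] @ map (\<lambda>k. (k, j)) [i+1..<j]"

definition is_segment_point :: "nat \<Rightarrow> (nat \<Rightarrow> nat) \<Rightarrow> nat set set \<Rightarrow> point \<Rightarrow> bool" where
  "is_segment_point n a E x \<longleftrightarrow>
     x \<in> U n \<and>
     (\<forall>(i, j) \<in> pairs n.
        ({i..j} \<notin> E \<longrightarrow> Poly_Mapping.lookup x (i, j) = 0) \<and>
        ({i..j} \<in> E \<longrightarrow> S x (corner_path i j) = (\<Sum>k = i..<j. real (a k))))"

definition segment_point :: "nat \<Rightarrow> (nat \<Rightarrow> nat) \<Rightarrow> nat set set \<Rightarrow> point" where
  "segment_point n a E = (THE x. is_segment_point n a E x)"

section \<open>Well-definedness\<close>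

lemma finite_pairs: "finite (pairs n)"
  by (rule finite_subset[of _ "{..n} \<times> {..n}"]) (auto simp: pairs_def)

lemma lookup_scaleR_point:
  "Poly_Mapping.lookup (c *\<^sub>R x) i = c *\<^sub>R Poly_Mapping.lookup x i"
proof -
  have "finite {i. c *\<^sub>R Poly_Mapping.lookup x i \<noteq> 0}"
    by (rule finite_subset[OF _ finite_keys[of x]]) (auto simp: in_keys_iff)
  then show ?thesis
    by (simp add: scaleR_poly_mapping_def)
qed

lemma linear_weyl_act: "linear (weyl_act n w)"
proof (rule linearI)
  fix x y :: weight and c :: real
  show "weyl_act n w (x + y) = weyl_act n w x + weyl_act n w y"
    by (simp add: weyl_act_def lookup_add sum.distrib scaleR_add_left)
  show "weyl_act n w (c *\<^sub>R x) = c *\<^sub>R weyl_act n w x"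
    by (simp add: weyl_act_def lookup_scaleR_point scaleR_sum_right flip: sum_distrib_left)
qed

lemma sum_eps: "(\<Sum>i = 1..m. eps n i) = fund_weight n m"
  by (induction m) (auto simp: eps_def fund_weight_def)

lemma weyl_act_eps:
  assumes w: "w permutes {1..n}" and i: "i \<in> {1..n}"
  shows "weyl_act n w (eps n i) = eps n (w i)"
proof -
  have fund: "weyl_act n w (fund_weight n m) = (\<Sum>j = 1..m. eps n (w j))" if "m \<le> n" for m
  proof (cases "1 \<le> m \<and> m < n")
    case True
    have "(\<Sum>k = j..<n. Poly_Mapping.lookup (fund_weight n m) k) = (if j \<le> m then 1 else 0)" for j
      using True by (simp add: fund_weight_def lookup_single when_def)
    then have "weyl_act n w (fund_weight n m) = (\<Sum>j = 1..n. if j \<le> m then eps n (w j) else 0)"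
      unfolding weyl_act_def by (intro sum.cong) auto
    also have "\<dots> = (\<Sum>j \<in> {1..n} \<inter> {j. j \<le> m}. eps n (w j))"
      by (simp add: sum.inter_restrict)
    also have "{1..n} \<inter> {j. j \<le> m} = {1..m}"
      using that by auto
    finally show ?thesis .
  next
    case False
    then have m: "m = 0 \<or> m = n" using that by auto
    have "(\<Sum>j = 1..n. eps n (w j)) = (\<Sum>j = 1..n. eps n j)"
      by (rule sum.permute[OF w, symmetric, unfolded o_def])
    then have "(\<Sum>j = 1..n. eps n (w j)) = 0"
      using sum_eps[of n n] by (simp add: fund_weight_def)
    moreover have "fund_weight n m = 0" unfolding fund_weight_def using False by (rule if_not_P)
    ultimately show ?thesis using m linear_0[OF linear_weyl_act] by auto
  qed
  obtain m where m: "i = Suc m" using i by (cases i) auto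
  have "weyl_act n w (eps n i) = weyl_act n w (fund_weight n i) - weyl_act n w (fund_weight n m)"
    by (simp add: eps_def m linear_diff[OF linear_weyl_act])
  also have "\<dots> = eps n (w i)"
    using i by (simp add: fund m)
  finally show ?thesis .
qed

lemma S_corner_path:
  assumes "i < j"
  shows "S x (corner_path i j) = Poly_Mapping.lookup x (i, j) +
    (\<Sum>k = i+1..<j. Poly_Mapping.lookup x (i, k) + Poly_Mapping.lookup x (k, j))"
  using assms
  by (simp add: S_def corner_path_def o_def sum_list_distinct_conv_sum_set sum.distrib
      interv_sum_list_conv_sum_set_nat)

function seg_coord :: "(nat \<Rightarrow> nat) \<Rightarrow> nat set set \<Rightarrow> nat \<Rightarrow> nat \<Rightarrow> real" where
  "seg_coord a E i j = (if {i..j} \<in> E then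
     (\<Sum>k = i..<j. real (a k)) - (\<Sum>k = i+1..<j. seg_coord a E i k + seg_coord a E k j) else 0)"
  by auto
termination by (relation "Wellfounded.measure (\<lambda>(a, E, i, j). j - i)") auto

declare seg_coord.simps [simp del]

lemma ex1_segment_point: "\<exists>!x. is_segment_point n a E x"
proof
  let ?f = "\<lambda>p. if p \<in> pairs n then seg_coord a E (fst p) (snd p) else 0"
  let ?x = "Abs_poly_mapping ?f"
  have "finite {p. ?f p \<noteq> 0}"
    by (rule finite_subset[OF _ finite_pairs[of n]]) auto
  then have x: "Poly_Mapping.lookup ?x = ?f" by simp
  have "S ?x (corner_path i j) = (\<Sum>k = i..<j. real (a k))"
    if "(i, j) \<in> pairs n" "{i..j} \<in> E" for i j
  proof -
    have ij: "1 \<le> i" "i < j" "j \<le> n" using that by (auto simp: pairs_def)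
    have "(\<Sum>k = i+1..<j. Poly_Mapping.lookup ?x (i, k) + Poly_Mapping.lookup ?x (k, j)) =
      (\<Sum>k = i+1..<j. seg_coord a E i k + seg_coord a E k j)"
      unfolding x using ij by (intro sum.cong) (auto simp: pairs_def)
    moreover have "Poly_Mapping.lookup ?x (i, j) = seg_coord a E i j" using that by (simp add: x)
    ultimately show ?thesis
      using that(2) by (simp add: S_corner_path[OF ij(2)] seg_coord.simps[of a E i j])
  qed
  moreover have "?x \<in> U n" by (auto simp: U_def in_keys_iff x split: if_splits)
  moreover have "Poly_Mapping.lookup ?x (i, j) = 0" if "{i..j} \<notin> E" for i j
    using that by (simp add: x seg_coord.simps[of a E i j])
  ultimately show "is_segment_point n a E ?x"
    by (auto simp: is_segment_point_def)
next
  have eq: "Poly_Mapping.lookup x (i, j) = seg_coord a E i j"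
    if x: "is_segment_point n a E x" and "(i, j) \<in> pairs n" for x i j
    using that(2)
  proof (induction "j - i" arbitrary: i j rule: less_induct)
    case less
    have ij: "1 \<le> i" "i < j" "j \<le> n" using less.prems by (auto simp: pairs_def)
    show ?case
    proof (cases "{i..j} \<in> E")
      case True
      have "(\<Sum>k = i+1..<j. Poly_Mapping.lookup x (i, k) + Poly_Mapping.lookup x (k, j)) =
        (\<Sum>k = i+1..<j. seg_coord a E i k + seg_coord a E k j)"
        using ij by (intro sum.cong refl arg_cong2[of _ _ _ _ "(+)"] less.hyps)
          (auto simp: pairs_def)
      moreover have "S x (corner_path i j) = (\<Sum>k = i..<j. real (a k))"
        using x less.prems True by (auto simp: is_segment_point_def)
      ultimately show ?thesis
        using True by (simp add: S_corner_path[OF ij(2)] seg_coord.simps[of a E i j])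
    next
      case False
      then show ?thesis
        using x less.prems by (auto simp: is_segment_point_def seg_coord.simps[of a E i j])
    qed
  qed
  fix y assume y: "is_segment_point n a E y"
  let ?f = "\<lambda>p. if p \<in> pairs n then seg_coord a E (fst p) (snd p) else 0"
  have "finite {p. ?f p \<noteq> 0}"
    by (rule finite_subset[OF _ finite_pairs[of n]]) auto
  moreover have "Poly_Mapping.lookup y = ?f"
  proof
    fix p
    show "Poly_Mapping.lookup y p = ?f p"
      using y eq[OF y, of "fst p" "snd p"] by (auto simp: is_segment_point_def U_def in_keys_iff)
  qed
  ultimately show "y = Abs_poly_mapping ?f"
    by (metis Poly_Mapping.lookup_inverse)
qed

end

theory Submission
  imports Defs
begin

text \<open>
  Put \<open>h i = a\<^sub>1 + \<dots> + a\<^bsub>i-1\<^esub>\<close>. A point of the polytope is read as a flow on \<open>{1..n}\<close> that moves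
  \<open>x\<^bsub>i,j\<^esub>\<close> units from \<open>i\<close> to \<open>j\<close>; it has weight \<open>w\<lambda>\<close> iff every \<open>k\<close> gains \<open>h k - h (s k)\<close>, where \<open>s\<close> is
  the inverse of \<open>w\<close>. Nested corner paths bound the flow into any set \<open>A\<close> by the sum of \<open>h\<close> over \<open>A\<close>
  minus the sum of \<open>h\<close> over \<open>{1..|A|}\<close>. For weight \<open>w\<lambda>\<close> the bound is attained by all sets
  \<open>{k. s k \<le> m}\<close>; this determines the last column of \<open>x\<close> and, by induction on \<open>n\<close>, all of \<open>x\<close>, which is
  therefore \<open>x(E)\<close> for a set of segments \<open>E\<close> built recursively from \<open>s\<close>. Since the bounds are linear
  inequalities that hold on the whole polytope, \<open>x\<close> is a vertex. A segment \<open>[k, n]\<close> may be added to an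
  intersection-closed set of segments in \<open>{1..n-1}\<close> iff \<open>k\<close> is a left-to-right maximum of the
  corresponding permutation, so the sets \<open>E\<close> are exactly the intersection-closed ones.
\<close>

section \<open>Cuts and hooks\<close>

text \<open>For \<open>b < e\<close> this is the support of \<open>corner_path b e\<close>; as a set
  it can be split along cuts.\<close>

definition hook :: "nat \<Rightarrow> nat \<Rightarrow> (nat \<times> nat) set" where
  "hook b e = {b} \<times> {b<..e} \<union> {b<..<e} \<times> {e}"

definition cut :: "nat \<Rightarrow> nat set \<Rightarrow> (nat \<times> nat) set" where
  "cut n A = {(i, j) \<in> pairs n. i \<notin> A \<and> j \<in> A}"

text \<open>A relaxation of the polytope that keeps only the corner path inequalities. Points are
  plain functions, so the same \<open>x\<close> serves for \<open>Suc n\<close> and for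
  \<open>n\<close> when the last column is dropped.\<close>

definition hook_polytope :: "nat \<Rightarrow> (nat \<Rightarrow> real) \<Rightarrow> (nat \<times> nat \<Rightarrow> real) set" where
  "hook_polytope n h = {x. (\<forall>p \<in> pairs n. 0 \<le> x p) \<and>
     (\<forall>(i, j) \<in> pairs n. sum x (hook i j) \<le> h j - h i)}"

lemma finite_hook [simp]: "finite (hook b e)"
  by (simp add: hook_def)

lemma hook_subset_pairs: "(b, e) \<in> pairs n \<Longrightarrow> hook b e \<subseteq> pairs n"
  by (auto simp: hook_def pairs_def)

lemma finite_cut [simp]: "finite (cut n A)"
  by (rule finite_subset[OF _ finite_pairs[of n]]) (auto simp: cut_def)

text \<open>Every subset of \<open>{1..n}\<close> is moved down to an initial interval by repeatedly replacing its
  largest element with the least missing one.\<close>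

lemma peel_induct [consumes 1, case_names initial peel]:
  fixes n :: nat
  assumes "A \<subseteq> {1..n}"
    and initial: "\<And>m. m \<le> n \<Longrightarrow> P {1..m}"
    and peel: "\<And>A b e. A \<subseteq> {1..n} \<Longrightarrow> 1 \<le> b \<Longrightarrow> {1..<b} \<subseteq> A \<Longrightarrow> b \<notin> A \<Longrightarrow> e \<in> A \<Longrightarrow> A \<subseteq> {..e} \<Longrightarrow>
      b < e \<Longrightarrow> P (insert b (A - {e})) \<Longrightarrow> P A"
  shows "P A"
  using assms(1)
proof (induction "\<Sum>A" arbitrary: A rule: less_induct)
  case less
  have fin: "finite A" using less.prems finite_subset by blast
  define b where "b = (LEAST k. 1 \<le> k \<and> k \<notin> A)"
  \<comment> \<open>\<open>Suc n\<close> is missing even if \<open>A\<close> is all of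
    \<open>{1..n}\<close>, so a least missing element exists.\<close>
  have "1 \<le> Suc n \<and> Suc n \<notin> A" using less.prems by auto
  then have b: "1 \<le> b \<and> b \<notin> A" unfolding b_def by (rule LeastI)
  have low: "{1..<b} \<subseteq> A"
  proof
    fix k assume "k \<in> {1..<b}"
    with not_less_Least[of k "\<lambda>k. 1 \<le> k \<and> k \<notin> A"] show "k \<in> A"
      unfolding b_def by simp
  qed
  show ?case
  proof (cases "A \<subseteq> {..b}")
    case True
    have "A \<subseteq> {1..<b}"
    proof
      fix k assume "k \<in> A"
      then have "k \<le> b" "k \<noteq> b" "1 \<le> k" using True b less.prems by auto
      then show "k \<in> {1..<b}" by simp
    qed
    then have "A = {1..<b}" using low by blast
    also have "\<dots> = {1..b - 1}" using b by auto
    finally have "A = {1..b - 1}" .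
    moreover have "b \<le> Suc n" unfolding b_def by (rule Least_le) fact
    ultimately show ?thesis using initial[of "b - 1"] by simp
  next
    case False
    define e where "e = Max A"
    from False have "A \<noteq> {}" by auto
    then have e: "e \<in> A" "A \<subseteq> {..e}" using fin by (auto simp: e_def)
    with False b have be: "b < e" by (meson atMost_subset_iff linorder_not_less order_trans)
    have "\<Sum>(insert b (A - {e})) = b + \<Sum>(A - {e})" using fin b by simp
    also have "\<dots> < e + \<Sum>(A - {e})" using be by simp
    also have "\<dots> = \<Sum>A" using sum.remove[OF fin e(1), of "\<lambda>k. k"] by simp
    finally have lt: "\<Sum>(insert b (A - {e})) < \<Sum>A" .
    have "insert b (A - {e}) \<subseteq> {1..n}" using less.prems b be e by auto
    with lt less.hyps have "P (insert b (A - {e}))" by blast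
    with peel[OF less.prems _ low _ e be] b show ?thesis by blast
  qed
qed

text \<open>Exchanging \<open>e\<close> for \<open>b\<close> gains no arc: an arc into
  \<open>b\<close> would start below \<open>b\<close>, hence in \<open>A\<close>, and no arc from
  \<open>e\<close> ends in \<open>A\<close>. The arcs lost end in \<open>e\<close> or start in
  \<open>b\<close>; they lie in the hook because \<open>A\<close> contains everything below
  \<open>b\<close> and nothing above \<open>e\<close>.\<close>

lemma sum_cut_peel:
  fixes x :: "nat \<times> nat \<Rightarrow> real"
  assumes A: "A \<subseteq> {1..n}" and b: "1 \<le> b" "{1..<b} \<subseteq> A" "b \<notin> A"
    and e: "e \<in> A" "A \<subseteq> {..e}" "b < e"
  shows "sum x (cut n A) = sum x (cut n A \<inter> hook b e) + sum x (cut n (insert b (A - {e})))"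
proof -
  have "cut n A = (cut n A \<inter> hook b e) \<union> cut n (insert b (A - {e}))"
  proof
    show "cut n A \<subseteq> (cut n A \<inter> hook b e) \<union> cut n (insert b (A - {e}))"
      using b e by (auto simp: cut_def hook_def pairs_def subset_iff)
    have "(i, j) \<in> cut n A" if "(i, j) \<in> cut n (insert b (A - {e}))" for i j
    proof -
      have *: "1 \<le> i" "i < j" "j \<le> n" "i \<noteq> b" "i \<notin> A - {e}" "j = b \<or> j \<in> A"
        using that by (auto simp: cut_def pairs_def)
      then have "j \<le> e" using e by auto
      then have "i \<notin> A" using * by auto
      then have "\<not> i < b" using b * by auto
      then have "j \<in> A" using * by auto
      then show ?thesis using * \<open>i \<notin> A\<close> by (auto simp: cut_def pairs_def)
    qed
    then show "(cut n A \<inter> hook b e) \<union> cut n (insert b (A - {e})) \<subseteq> cut n A" by auto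
  qed
  moreover have "(cut n A \<inter> hook b e) \<inter> cut n (insert b (A - {e})) = {}"
    using e by (auto simp: cut_def hook_def pairs_def)
  ultimately show ?thesis
    by (metis finite_Int finite_cut sum.union_disjoint)
qed

lemma sum_hook_cut_le:
  fixes x :: "nat \<times> nat \<Rightarrow> real"
  assumes "x \<in> hook_polytope n h" "(b, e) \<in> pairs n"
  shows "sum x (cut n A \<inter> hook b e) \<le> sum x (hook b e)" "sum x (hook b e) \<le> h e - h b"
proof -
  show "sum x (cut n A \<inter> hook b e) \<le> sum x (hook b e)"
    using assms hook_subset_pairs[OF assms(2)]
    by (intro sum_mono2) (auto simp: hook_polytope_def)
  show "sum x (hook b e) \<le> h e - h b"
    using assms by (auto simp: hook_polytope_def)
qed

lemma sum_insert_diff: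
  fixes h :: "'a \<Rightarrow> 'b::ab_group_add"
  assumes "finite A" "b \<notin> A" "e \<in> A"
  shows "sum h A = sum h (insert b (A - {e})) + (h e - h b)"
  using assms sum.remove[OF assms(1,3), of h] by simp

lemma card_insert_diff:
  assumes "finite A" "b \<notin> A" "e \<in> A"
  shows "card (insert b (A - {e})) = card A"
  using assms card.remove[OF assms(1,3)] by simp

text \<open>Along the peeling each hook contributes at most \<open>h e - h b\<close>, exactly the
  drop of \<open>sum h\<close>; the cardinality stays fixed, and an initial interval has no incoming
  arc.\<close>

lemma sum_cut_le:
  assumes "x \<in> hook_polytope n h" "A \<subseteq> {1..n}"
  shows "sum x (cut n A) \<le> sum h A - sum h {1..card A}"
  using assms(2)
proof (induction rule: peel_induct)
  case (initial m)
  have "cut n {1..m} = {}" by (auto simp: cut_def pairs_def)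
  then show ?case by simp
next
  case (peel A b e)
  have fin: "finite A" using peel.hyps(1) finite_subset by blast
  note s = sum_insert_diff[OF fin peel.hyps(4,5), of h] card_insert_diff[OF fin peel.hyps(4,5)]
  have "(b, e) \<in> pairs n" using peel.hyps by (auto simp: pairs_def)
  from sum_hook_cut_le(1)[OF assms(1) this, of A] sum_hook_cut_le(2)[OF assms(1) this] peel.IH s sum_cut_peel[OF peel.hyps(1-7), of x]
  show ?case by simp
qed

text \<open>The bound of \<open>sum_cut_le\<close> adds up hook inequalities, so equality forces the
  first hook to be tight, with all its mass on arcs of the cut.\<close>

lemma tight_cut_hook:
  assumes x: "x \<in> hook_polytope n h" and A: "A \<subseteq> {1..n}"
    and b: "1 \<le> b" "{1..<b} \<subseteq> A" "b \<notin> A" and e: "e \<in> A" "A \<subseteq> {..e}" "b < e"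
    and tight: "sum x (cut n A) = sum h A - sum h {1..card A}"
  shows "sum x (hook b e) = h e - h b"
    and "\<And>p. p \<in> hook b e \<Longrightarrow> p \<notin> cut n A \<Longrightarrow> x p = 0"
proof -
  have fin: "finite A" using A finite_subset by blast
  note s = sum_insert_diff[OF fin b(3) e(1), of h] card_insert_diff[OF fin b(3) e(1)]
  have "e \<le> n" using A e by auto
  then have be: "(b, e) \<in> pairs n" using b e by (simp add: pairs_def)
  have "insert b (A - {e}) \<subseteq> {1..n}" using A b e \<open>e \<le> n\<close> by auto
  note le = sum_cut_le[OF x this]
  note hk = sum_hook_cut_le(1)[OF x be, of A] sum_hook_cut_le(2)[OF x be]
  have eq: "sum x (cut n A \<inter> hook b e) = h e - h b"
    using le hk s tight sum_cut_peel[OF A b e, of x] by simp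
  then show "sum x (hook b e) = h e - h b" using hk by simp
  have "sum x (hook b e) = sum x (hook b e \<inter> cut n A) + sum x (hook b e - cut n A)"
    by (rule sum.Int_Diff) simp
  then have "sum x (hook b e - cut n A) = 0" using eq hk by (simp add: Int_commute)
  moreover have "\<forall>p \<in> hook b e - cut n A. 0 \<le> x p"
    using x hook_subset_pairs[OF be] by (auto simp: hook_polytope_def)
  ultimately have "\<forall>p \<in> hook b e - cut n A. x p = 0"
    by (subst (asm) sum_nonneg_eq_0_iff) auto
  then show "\<And>p. p \<in> hook b e \<Longrightarrow> p \<notin> cut n A \<Longrightarrow> x p = 0" by blast
qed

section \<open>Flows\<close>

definition netflow :: "nat \<Rightarrow> (nat \<times> nat \<Rightarrow> real) \<Rightarrow> nat \<Rightarrow> real" where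
  "netflow n x k = sum x {p \<in> pairs n. snd p = k} - sum x {p \<in> pairs n. fst p = k}"

definition sublevel :: "nat \<Rightarrow> (nat \<Rightarrow> nat) \<Rightarrow> nat \<Rightarrow> nat set" where
  "sublevel n s m = {k \<in> {1..n}. s k \<le> m}"

text \<open>Arcs with both ends in \<open>A\<close> cancel.\<close>

lemma sum_netflow:
  assumes "A \<subseteq> {1..n}"
  shows "(\<Sum>k \<in> A. netflow n x k) = sum x (cut n A) - sum x (cut n ({1..n} - A))"
proof -
  have fin: "finite A" using assms finite_subset by blast
  have gr: "(\<Sum>k \<in> A. sum x {p \<in> pairs n. g p = k}) = sum x {p \<in> pairs n. g p \<in> A}" for g
  proof -
    have "(\<Sum>k \<in> A. sum x {p \<in> pairs n. g p = k}) =
        (\<Sum>k \<in> A. sum x {p \<in> {p \<in> pairs n. g p \<in> A}. g p = k})"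
      by (intro sum.cong arg_cong[where f = "sum x"]) auto
    also have "\<dots> = sum x {p \<in> pairs n. g p \<in> A}"
      using fin finite_pairs[of n] by (intro sum.group) auto
    finally show ?thesis .
  qed
  let ?B = "{p \<in> pairs n. fst p \<in> A \<and> snd p \<in> A}"
  have fB: "finite ?B" using finite_pairs[of n] by simp
  have "{p \<in> pairs n. snd p \<in> A} = cut n A \<union> ?B" "cut n A \<inter> ?B = {}"
    by (auto simp: cut_def)
  moreover have "{p \<in> pairs n. fst p \<in> A} = cut n ({1..n} - A) \<union> ?B" "cut n ({1..n} - A) \<inter> ?B = {}"
    by (auto simp: cut_def pairs_def)
  ultimately show ?thesis
    unfolding netflow_def sum_subtractf gr using fB by (simp add: sum.union_disjoint)
qed

lemma pairs_Suc: "pairs (Suc n) = pairs n \<union> {1..n} \<times> {Suc n}"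
  by (auto simp: pairs_def)

lemma netflow_Suc:
  assumes "k \<in> {1..n}"
  shows "netflow n x k = netflow (Suc n) x k + x (k, Suc n)"
proof -
  have "{p \<in> pairs (Suc n). snd p = k} = {p \<in> pairs n. snd p = k}"
    using assms by (auto simp: pairs_Suc)
  moreover have "{p \<in> pairs (Suc n). fst p = k} = insert (k, Suc n) {p \<in> pairs n. fst p = k}"
    using assms by (auto simp: pairs_Suc)
  moreover have "(k, Suc n) \<notin> pairs n" by (simp add: pairs_def)
  ultimately show ?thesis
    using finite_pairs[of n] by (simp add: netflow_def)
qed

lemma netflow_last: "netflow (Suc n) x (Suc n) = (\<Sum>i = 1..n. x (i, Suc n))"
proof -
  have "{p \<in> pairs (Suc n). snd p = Suc n} = (\<lambda>i. (i, Suc n)) ` {1..n}"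
    "{p \<in> pairs (Suc n). fst p = Suc n} = {}"
    by (auto simp: pairs_def)
  then show ?thesis
    unfolding netflow_def by (simp only: sum.empty) (simp add: sum.reindex inj_on_def)
qed

lemma image_sublevel:
  assumes "s permutes {1..n}" "m \<le> n"
  shows "s ` sublevel n s m = {1..m}"
proof -
  have "s ` sublevel n s m = {k \<in> s ` {1..n}. k \<le> m}" by (auto simp: sublevel_def)
  then show ?thesis using permutes_image[OF assms(1)] assms(2) by auto
qed

lemma sum_sublevel:
  fixes h :: "nat \<Rightarrow> real"
  assumes "s permutes {1..n}" "m \<le> n"
  shows "(\<Sum>k \<in> sublevel n s m. h (s k)) = sum h {1..m}" and "card (sublevel n s m) = m"
proof -
  have inj: "inj_on s (sublevel n s m)" using permutes_inj[OF assms(1)] by (simp add: inj_on_def)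
  show "(\<Sum>k \<in> sublevel n s m. h (s k)) = sum h {1..m}"
    using sum.reindex[OF inj, of h] image_sublevel[OF assms] by simp
  show "card (sublevel n s m) = m"
    using card_image[OF inj] image_sublevel[OF assms] by simp
qed

lemma sublevel_subset: "sublevel n s m \<subseteq> {1..n}"
  by (auto simp: sublevel_def)

text \<open>The permutation is a parameter because deleting the last vertex replaces it by
  \<open>down\<close>, while \<open>h\<close> and \<open>x\<close> stay the same.\<close>

locale flow =
  fixes n :: nat and h :: "nat \<Rightarrow> real" and x :: "nat \<times> nat \<Rightarrow> real" and s :: "nat \<Rightarrow> nat"
  assumes polytope: "x \<in> hook_polytope n h"
    and perm: "s permutes {1..n}"
    and netflow: "k \<in> {1..n} \<Longrightarrow> netflow n x k = h k - h (s k)"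
begin

lemma nonneg: "p \<in> pairs n \<Longrightarrow> 0 \<le> x p"
  using polytope by (auto simp: hook_polytope_def)

lemma s_eq_iff [simp]: "s i = s j \<longleftrightarrow> i = j"
  using permutes_inj[OF perm] by (auto dest: injD)

lemma s_range: "k \<in> {1..n} \<Longrightarrow> s k \<in> {1..n}"
  using permutes_in_image[OF perm] by simp

text \<open>Since \<open>s\<close> maps the sublevel set onto \<open>{1..m}\<close>, its total gain
  equals the upper bound for the inflow. Hence the inflow is maximal and the nonnegative outflow
  vanishes.\<close>

lemma cut_sublevel:
  assumes "m \<le> n"
  shows "sum x (cut n (sublevel n s m)) =
      sum h (sublevel n s m) - sum h {1..card (sublevel n s m)}"
    and "\<And>p. p \<in> cut n ({1..n} - sublevel n s m) \<Longrightarrow> x p = 0"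
proof -
  let ?A = "sublevel n s m"
  have "(\<Sum>k \<in> ?A. netflow n x k) = (\<Sum>k \<in> ?A. h k - h (s k))"
    using sublevel_subset by (intro sum.cong netflow refl) blast
  also have "\<dots> = sum h ?A - sum h {1..card ?A}"
    by (simp add: sum_subtractf sum_sublevel[OF perm assms])
  finally have eq: "sum x (cut n ?A) - sum x (cut n ({1..n} - ?A)) = sum h ?A - sum h {1..card ?A}"
    by (simp add: sum_netflow[OF sublevel_subset])
  have nn: "\<forall>p \<in> cut n ({1..n} - ?A). 0 \<le> x p"
    using nonneg by (auto simp: cut_def)
  then have "0 \<le> sum x (cut n ({1..n} - ?A))" by (simp add: sum_nonneg)
  with eq sum_cut_le[OF polytope sublevel_subset, of s m]
  have "sum x (cut n ?A) = sum h ?A - sum h {1..card ?A}" "sum x (cut n ({1..n} - ?A)) = 0"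
    by linarith+
  then show "sum x (cut n ?A) = sum h ?A - sum h {1..card ?A}"
    and "\<And>p. p \<in> cut n ({1..n} - ?A) \<Longrightarrow> x p = 0"
    using nn by (simp_all add: sum_nonneg_eq_0_iff)
qed

lemma no_inversion_zero:
  assumes "(i, j) \<in> pairs n" "s i < s j"
  shows "x (i, j) = 0"
proof (rule cut_sublevel(2)[of "s i"])
  have "i \<in> {1..n}" "j \<in> {1..n}" using assms(1) by (auto simp: pairs_def)
  with s_range[of i] assms show "s i \<le> n" "(i, j) \<in> cut n ({1..n} - sublevel n s (s i))"
    by (auto simp: cut_def sublevel_def)
qed

end

section \<open>The segments attached to a permutation\<close>

text \<open>Deleting the last position of \<open>s\<close> shifts its left-to-right maxima above the last value down
  along the chain of these maxima.\<close>

definition prev_max :: "nat \<Rightarrow> (nat \<Rightarrow> nat) \<Rightarrow> nat \<Rightarrow> nat" where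
  "prev_max n s k = Max (insert (s (Suc n)) (s ` {1..<k}))"

definition records :: "nat \<Rightarrow> (nat \<Rightarrow> nat) \<Rightarrow> nat set" where
  "records n s = {k \<in> {1..n}. prev_max n s k < s k}"

definition down :: "nat \<Rightarrow> (nat \<Rightarrow> nat) \<Rightarrow> nat \<Rightarrow> nat" where
  "down n s k = (if k \<in> {1..n} then min (s k) (prev_max n s k) else k)"

text \<open>Column \<open>Suc n\<close> of a flow vanishes off the records, and the hooks at records
  are tight; the other columns form a flow for \<open>down n s\<close>, whence the
  recursion.\<close>

primrec seg :: "nat \<Rightarrow> (nat \<Rightarrow> nat) \<Rightarrow> (nat \<times> nat) set" where
  "seg 0 s = {}"
| "seg (Suc n) s = seg n (down n s) \<union> records n s \<times> {Suc n}"

lemma prev_max_less_iff: "prev_max n s k < m \<longleftrightarrow> s (Suc n) < m \<and> (\<forall>i \<in> {1..<k}. s i < m)"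
  by (simp add: prev_max_def)

lemma le_prev_max: "s (Suc n) \<le> prev_max n s k" "i \<in> {1..<k} \<Longrightarrow> s i \<le> prev_max n s k"
  unfolding prev_max_def by (rule Max_ge; auto)+

lemma prev_max_cases: "prev_max n s k = s (Suc n) \<or> (\<exists>i \<in> {1..<k}. prev_max n s k = s i)"
proof -
  have "prev_max n s k \<in> insert (s (Suc n)) (s ` {1..<k})"
    unfolding prev_max_def by (rule Max_in) auto
  then show ?thesis by auto
qed

lemma prev_max_mono: "i \<le> k \<Longrightarrow> prev_max n s i \<le> prev_max n s k"
  unfolding prev_max_def by (rule Max_mono) auto

lemma seg_subset_pairs: "seg n s \<subseteq> pairs n"
  by (induction n arbitrary: s) (auto simp: pairs_Suc records_def)

text \<open>Take \<open>i < k\<close>. If \<open>k\<close> keeps \<open>s k\<close>, this differs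
  from \<open>s i\<close> and from \<open>prev_max n s i\<close>, the value of another position.
  Otherwise \<open>k\<close> receives \<open>prev_max n s k\<close>, which bounds both
  \<open>s i\<close> and \<open>prev_max n s i\<close> and so exceeds the smaller of these distinct
  numbers.\<close>

lemma down_permutes:
  assumes "s permutes {1..Suc n}"
  shows "down n s permutes {1..n}"
proof (rule bij_imp_permutes)
  have inj: "s i = s j \<longleftrightarrow> i = j" for i j
    using permutes_inj[OF assms] by (auto dest: injD)
  have neq: "s k \<noteq> prev_max n s k" if "k \<in> {1..n}" for k
    using prev_max_cases[of n s k] that inj by auto
  have "down n s i \<noteq> down n s k" if ik: "i \<in> {1..n}" "k \<in> {1..n}" "i < k" for i k
  proof (cases "s k < prev_max n s k")
    case True
    then have "down n s k = s k" using ik by (simp add: down_def)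
    moreover have "s i \<noteq> s k" using ik inj by simp
    moreover have "prev_max n s i \<noteq> s k" using prev_max_cases[of n s i] ik inj by auto
    ultimately show ?thesis using ik by (auto simp: down_def min_def)
  next
    case False
    then have "down n s k = prev_max n s k" using ik by (simp add: down_def)
    moreover have "s i \<le> prev_max n s k" "prev_max n s i \<le> prev_max n s k"
      using ik by (auto intro: le_prev_max prev_max_mono)
    ultimately show ?thesis using ik neq[of i] by (auto simp: down_def min_def)
  qed
  then have inj_down: "inj_on (down n s) {1..n}"
    by (intro inj_onI) (metis nat_neq_iff)
  have range: "s k \<in> {1..Suc n}" if "k \<in> {1..Suc n}" for k
    using permutes_in_image[OF assms] that by simp
  \<comment> \<open>The minimum of two distinct numbers that are at most \<open>Suc n\<close> is at
    most \<open>n\<close>.\<close>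
  have "down n s k \<in> {1..n}" if k: "k \<in> {1..n}" for k
  proof -
    have "s k \<in> {1..Suc n}" "s (Suc n) \<in> {1..Suc n}" using range k by auto
    moreover have "prev_max n s k \<le> Suc n"
      using range k by (auto simp: prev_max_def)
    moreover have "1 \<le> prev_max n s k" using \<open>s (Suc n) \<in> _\<close> le_prev_max(1)[of s n k] by simp
    ultimately show ?thesis using neq[OF k] k by (auto simp: down_def min_def)
  qed
  then have "down n s ` {1..n} \<subseteq> {1..n}" by blast
  with inj_down show "bij_betw (down n s) {1..n} {1..n}"
    by (simp add: bij_betw_def endo_inj_surj)
  show "\<And>k. k \<notin> {1..n} \<Longrightarrow> down n s k = k" unfolding down_def by (rule if_not_P)
qed

section \<open>The last column of a flow\<close>

locale flow_Suc = flow "Suc n" h x s for n h x s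
begin

lemma s_le_Suc: "k \<in> {1..Suc n} \<Longrightarrow> s k \<le> Suc n"
  using s_range by fastforce

text \<open>At level \<open>prev_max n s b\<close> the sublevel set contains \<open>{1..<b}\<close>
  and \<open>Suc n\<close> but not \<open>b\<close>, so \<open>hook b (Suc n)\<close> is the first
  hook peeled off.\<close>

lemma last_column_tight:
  assumes "b \<in> records n s"
  shows "sum x (hook b (Suc n)) = h (Suc n) - h b"
proof -
  let ?m = "prev_max n s b"
  let ?A = "sublevel (Suc n) s ?m"
  have b: "b \<in> {1..n}" "?m < s b" using assms by (auto simp: records_def)
  have m: "?m \<le> Suc n" using b s_le_Suc[of b] by simp
  show ?thesis
  proof (rule tight_cut_hook(1)[OF polytope sublevel_subset _ _ _ _ _ _ cut_sublevel(1)[OF m]])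
    show "{1..<b} \<subseteq> ?A" using b le_prev_max(2)[of _ b s n] by (auto simp: sublevel_def)
    show "Suc n \<in> ?A" using le_prev_max(1)[of s n b] by (auto simp: sublevel_def)
  qed (use b in \<open>auto simp: sublevel_def\<close>)
qed

text \<open>A non-record either has a value below \<open>s (Suc n)\<close>, or a larger value occurs
  earlier. In the second case the sublevel set of level \<open>s k\<close> contains
  \<open>k\<close>, and its first peeled hook passes through \<open>(k, Suc n)\<close>, which is not
  an arc of the cut.\<close>

lemma last_column_zero:
  assumes k: "k \<in> {1..n}" "k \<notin> records n s"
  shows "x (k, Suc n) = 0"
proof (cases "s k < s (Suc n)")
  case True
  then show ?thesis using k no_inversion_zero[of k "Suc n"] by (auto simp: pairs_def)
next
  case False
  have "s k \<noteq> s (Suc n)" using k by simp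
  with False have less: "s (Suc n) < s k" by linarith
  define b where "b = (LEAST b. 1 \<le> b \<and> s k < s b)"
  obtain i where i: "1 \<le> i" "i < k" "\<not> s i < s k"
    using k less by (auto simp: records_def prev_max_less_iff)
  moreover have "s i \<noteq> s k" using i by simp
  ultimately have "1 \<le> i \<and> s k < s i" by linarith
  then have b: "1 \<le> b \<and> s k < s b" "b \<le> i"
    unfolding b_def by (rule LeastI, rule Least_le)
  have low: "s j \<le> s k" if "1 \<le> j" "j < b" for j
    using not_less_Least[of j "\<lambda>b. 1 \<le> b \<and> s k < s b"] that by (simp add: b_def not_less)
  let ?A = "sublevel (Suc n) s (s k)"
  have m: "s k \<le> Suc n" using k s_le_Suc[of k] by simp
  show ?thesis
  proof (rule tight_cut_hook(2)[OF polytope sublevel_subset _ _ _ _ _ _ cut_sublevel(1)[OF m]])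
    show "{1..<b} \<subseteq> ?A" using b i k low by (auto simp: sublevel_def)
    show "Suc n \<in> ?A" using less by (auto simp: sublevel_def)
    show "(k, Suc n) \<in> hook b (Suc n)" using b i k by (auto simp: hook_def)
    show "(k, Suc n) \<notin> cut (Suc n) ?A" using k by (auto simp: cut_def sublevel_def)
  qed (use b i k in \<open>auto simp: sublevel_def\<close>)
qed

lemma last_column_total: "(\<Sum>i = 1..n. x (i, Suc n)) = h (Suc n) - h (s (Suc n))"
  using netflow[of "Suc n"] by (simp add: netflow_last)

text \<open>Nothing enters a left-to-right maximum, so row \<open>b\<close> sums to
  \<open>h (s b) - h b\<close>. Subtracting this from the tight hook leaves the last column in the
  rows after \<open>b\<close>.\<close>

lemma last_column_tail:
  assumes "b \<in> records n s"
  shows "(\<Sum>i \<in> {b<..n}. x (i, Suc n)) = h (Suc n) - h (s b)"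
proof -
  have b: "b \<in> {1..n}" "\<And>i. i \<in> {1..<b} \<Longrightarrow> s i < s b"
    using assms by (auto simp: records_def prev_max_less_iff)
  have "x p = 0" if "p \<in> {p \<in> pairs (Suc n). snd p = b}" for p
    using that no_inversion_zero[of "fst p" b] b(2)[of "fst p"] by (cases p) (auto simp: pairs_def)
  then have "sum x {p \<in> pairs (Suc n). snd p = b} = 0" by (rule sum.neutral[OF ballI])
  moreover have "{p \<in> pairs (Suc n). fst p = b} = {b} \<times> {b<..Suc n}"
    using b by (auto simp: pairs_def)
  ultimately have row: "sum x ({b} \<times> {b<..Suc n}) = h (s b) - h b"
    using netflow[of b] b by (simp add: netflow_def)
  have "hook b (Suc n) = {b} \<times> {b<..Suc n} \<union> (\<lambda>i. (i, Suc n)) ` {b<..n}"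
    by (auto simp: hook_def)
  then have "sum x (hook b (Suc n)) =
      sum x ({b} \<times> {b<..Suc n}) + sum x ((\<lambda>i. (i, Suc n)) ` {b<..n})"
    by (simp only:) (rule sum.union_disjoint; auto)
  then show ?thesis
    using row last_column_tight[OF assms] by (simp add: sum.reindex inj_on_def)
qed

text \<open>At a record the entry is a difference of consecutive tails: the tail of the previous
  record, or the whole column if there is none, minus the tail of \<open>k\<close>.\<close>

lemma last_column:
  assumes k: "k \<in> {1..n}"
  shows "x (k, Suc n) = h (s k) - h (down n s k)"
proof (cases "k \<in> records n s")
  case False
  then have "down n s k = s k" using k by (auto simp: records_def down_def)
  then show ?thesis using last_column_zero[OF k False] by simp
next
  case True
  then have less: "prev_max n s k < s k" by (simp add: records_def)
  have down: "down n s k = prev_max n s k" using less k by (simp add: down_def)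
  have zero: "sum (\<lambda>i. x (i, Suc n)) B = 0" if "B \<subseteq> {1..n} - records n s" for B
    using that last_column_zero by (intro sum.neutral) blast
  consider "prev_max n s k = s (Suc n)" | i where "i \<in> {1..<k}" "prev_max n s k = s i"
    using prev_max_cases[of n s k] by auto
  then show ?thesis
  proof cases
    case 1
    have "i \<notin> records n s" if "i \<in> {1..<k}" for i
      using le_prev_max(2)[of i k s n] that le_prev_max(1)[of s n i] 1 by (auto simp: records_def)
    then have "sum (\<lambda>i. x (i, Suc n)) {1..<k} = 0" using k by (intro zero) auto
    moreover have "{1..n} = {1..<k} \<union> insert k {k<..n}" using k by auto
    then have "(\<Sum>i = 1..n. x (i, Suc n)) =
        sum (\<lambda>i. x (i, Suc n)) {1..<k} + sum (\<lambda>i. x (i, Suc n)) (insert k {k<..n})"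
      by (simp only:) (rule sum.union_disjoint; auto)
    ultimately show ?thesis
      using last_column_total last_column_tail[OF True] by (simp add: down 1)
  next
    \<comment> \<open>Here \<open>i\<close> is the record preceding \<open>k\<close>.\<close>
    case 2
    have "s j \<noteq> s i" if "j \<in> {1..<i} \<union> {Suc n}" for j using that 2 k by auto
    moreover have "s j \<le> s i" if "j \<in> {1..<i} \<union> {Suc n}" for j
      using that 2 le_prev_max(1)[of s n k] le_prev_max(2)[of j k s n] by auto
    ultimately have "s j < s i" if "j \<in> {1..<i} \<union> {Suc n}" for j
      using that order_le_neq_trans by blast
    then have "prev_max n s i < s i" unfolding prev_max_less_iff by blast
    then have i: "i \<in> records n s" using 2 k by (simp add: records_def)
    have "j \<notin> records n s" if "j \<in> {i<..<k}" for j
    proof -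
      have "s j \<le> s i" using le_prev_max(2)[of j k s n] that 2 by simp
      moreover have "s i \<le> prev_max n s j" using le_prev_max(2)[of i j s n] that 2 by simp
      ultimately show ?thesis by (simp add: records_def)
    qed
    then have "sum (\<lambda>i. x (i, Suc n)) {i<..<k} = 0" using k 2 by (intro zero) auto
    moreover have "{i<..n} = {i<..<k} \<union> insert k {k<..n}" using k 2 by auto
    then have "(\<Sum>i \<in> {i<..n}. x (i, Suc n)) =
        sum (\<lambda>i. x (i, Suc n)) {i<..<k} + sum (\<lambda>i. x (i, Suc n)) (insert k {k<..n})"
      by (simp only:) (rule sum.union_disjoint; auto)
    ultimately show ?thesis
      using last_column_tail[OF i] last_column_tail[OF True] by (simp add: down 2)
  qed
qed

lemma flow_down: "flow n h x (down n s)"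
proof
  show "x \<in> hook_polytope n h" using polytope by (auto simp: hook_polytope_def pairs_Suc)
  show "down n s permutes {1..n}" using perm by (rule down_permutes)
  show "netflow n x k = h k - h (down n s k)" if "k \<in> {1..n}" for k
    using that netflow[of k] last_column[OF that] netflow_Suc[OF that, of x] by simp
qed

end

text \<open>Columns are removed from the right, replacing \<open>s\<close> by
  \<open>down n s\<close> each time. The conclusions are the equations that define
  \<open>x(E)\<close>.\<close>

theorem flow_seg:
  assumes "flow n h x s" "(i, j) \<in> pairs n"
  shows "(i, j) \<notin> seg n s \<Longrightarrow> x (i, j) = 0"
    and "(i, j) \<in> seg n s \<Longrightarrow> sum x (hook i j) = h j - h i"
proof -
  have "((i, j) \<notin> seg n s \<longrightarrow> x (i, j) = 0) \<and>
      ((i, j) \<in> seg n s \<longrightarrow> sum x (hook i j) = h j - h i)"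
    using assms
  proof (induction n arbitrary: s)
    case 0
    then show ?case by (simp add: pairs_def)
  next
    case (Suc n)
    interpret flow_Suc n h x s using Suc.prems(1) by (simp add: flow_Suc_def)
    show ?case
    proof (cases "j = Suc n")
      case True
      then have "i \<in> {1..n}" using Suc.prems(2) by (auto simp: pairs_def)
      moreover have "(i, j) \<notin> seg n (down n s)"
        using seg_subset_pairs[of n "down n s"] True by (auto simp: pairs_def)
      ultimately show ?thesis
        using True last_column_zero[of i] last_column_tight[of i] by auto
    next
      case False
      then have "(i, j) \<in> pairs n" using Suc.prems(2) by (auto simp: pairs_Suc)
      then show ?thesis using Suc.IH[OF flow_down] False by simp
    qed
  qed
  then show "(i, j) \<notin> seg n s \<Longrightarrow> x (i, j) = 0"
    and "(i, j) \<in> seg n s \<Longrightarrow> sum x (hook i j) = h j - h i"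
    by auto
qed

section \<open>Intersection-closed sets of segments\<close>

text \<open>Equality of \<open>max i i'\<close> and \<open>min j j'\<close> is included: it demands
  a pair \<open>(k, k)\<close>, which no subset of \<open>pairs n\<close> contains, and so forbids
  segments that meet in one point.\<close>

definition inter_closed :: "(nat \<times> nat) set \<Rightarrow> bool" where
  "inter_closed F \<longleftrightarrow> (\<forall>i j i' j'. (i, j) \<in> F \<longrightarrow> (i', j') \<in> F \<longrightarrow> max i i' \<le> min j j' \<longrightarrow>
     (max i i', min j j') \<in> F)"

text \<open>\<open>allowed F k\<close> says that adding a segment with left end \<open>k\<close> which reaches beyond all segments
  of \<open>F\<close> keeps \<open>F\<close> closed under intersection.\<close>

definition allowed :: "(nat \<times> nat) set \<Rightarrow> nat \<Rightarrow> bool" where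
  "allowed F k \<longleftrightarrow> (\<forall>i j. (i, j) \<in> F \<longrightarrow> i < k \<longrightarrow> k \<le> j \<longrightarrow> (k, j) \<in> F)"

definition lr_max :: "(nat \<Rightarrow> nat) \<Rightarrow> nat \<Rightarrow> bool" where
  "lr_max s k \<longleftrightarrow> (\<forall>i \<in> {1..<k}. s i < s k)"

text \<open>Two segments ending in \<open>Suc n\<close> meet in one of them. A segment
  \<open>[i, j]\<close> of \<open>F\<close> that meets \<open>[k, Suc n]\<close> is itself the
  intersection if \<open>k \<le> i\<close>, so only \<open>i < k\<close> imposes a
  condition.\<close>

lemma inter_closed_Suc:
  assumes F: "F \<subseteq> pairs n" and K: "K \<subseteq> {1..n}"
  shows "inter_closed (F \<union> K \<times> {Suc n}) \<longleftrightarrow> inter_closed F \<and> (\<forall>k \<in> K. allowed F k)"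
    (is "inter_closed ?G \<longleftrightarrow> _")
proof
  have F': "1 \<le> i" "i < j" "j \<le> n" if "(i, j) \<in> F" for i j
    using F that by (auto simp: pairs_def)
  {
    assume G: "inter_closed ?G"
    have "inter_closed F"
      unfolding inter_closed_def
    proof (intro allI impI)
      fix i j i' j' assume *: "(i, j) \<in> F" "(i', j') \<in> F" "max i i' \<le> min j j'"
      then have "(max i i', min j j') \<in> ?G" using G unfolding inter_closed_def by blast
      moreover have "min j j' \<noteq> Suc n" using F'[OF *(1)] by simp
      ultimately show "(max i i', min j j') \<in> F" by auto
    qed
    moreover have "allowed F k" if "k \<in> K" for k
      unfolding allowed_def
    proof (intro allI impI)
      fix i j assume *: "(i, j) \<in> F" "i < k" "k \<le> j"
      then have "(max k i, min (Suc n) j) \<in> ?G"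
        using that F'[OF *(1)] G[unfolded inter_closed_def, rule_format, of k "Suc n" i j] by auto
      moreover have "max k i = k" "min (Suc n) j = j" "j \<noteq> Suc n" using * F'[OF *(1)] by auto
      ultimately show "(k, j) \<in> F" by auto
    qed
    ultimately show "inter_closed F \<and> (\<forall>k \<in> K. allowed F k)" by blast
  }
  assume *: "inter_closed F \<and> (\<forall>k \<in> K. allowed F k)"
  have mixed: "(max k i, min (Suc n) j) \<in> F" if "k \<in> K" "(i, j) \<in> F" "k \<le> j" for k i j
  proof (cases "i < k")
    case True
    then have "(k, j) \<in> F" using * that by (auto simp: allowed_def)
    then show ?thesis using True F'[OF that(2)] by (simp add: max_def min_def)
  next
    case False
    then show ?thesis using that F'[OF that(2)] by (simp add: max_def min_def)
  qed
  show "inter_closed ?G"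
    unfolding inter_closed_def
  proof (intro allI impI)
    fix i j i' j' assume ij: "(i, j) \<in> ?G" "(i', j') \<in> ?G" "max i i' \<le> min j j'"
    then consider "(i, j) \<in> F" "(i', j') \<in> F" | "i \<in> K" "j = Suc n" "(i', j') \<in> F"
      | "(i, j) \<in> F" "i' \<in> K" "j' = Suc n" | "i \<in> K" "j = Suc n" "i' \<in> K" "j' = Suc n"
      by auto
    then show "(max i i', min j j') \<in> ?G"
    proof cases
      case 1
      then show ?thesis using * ij(3) unfolding inter_closed_def by blast
    next
      case 2
      then show ?thesis using mixed[of i i' j'] ij(3) by auto
    next
      case 3
      then show ?thesis using mixed[of i' i j] ij(3) by (auto simp: max.commute min.commute)
    next
      case 4
      then show ?thesis by (auto simp: max_def)
    qed
  qed
qed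

text \<open>A new segment \<open>[i, Suc n]\<close> with \<open>i < k\<close> reaches past
  \<open>k\<close> and demands \<open>[k, Suc n]\<close>.\<close>

lemma allowed_Suc:
  assumes "F \<subseteq> pairs n" "K \<subseteq> {1..n}" "k \<in> {1..n}"
  shows "allowed (F \<union> K \<times> {Suc n}) k \<longleftrightarrow> allowed F k \<and> ((\<exists>i \<in> K. i < k) \<longrightarrow> k \<in> K)"
proof -
  have "j \<noteq> Suc n" if "(i, j) \<in> F" for i j using assms(1) that by (auto simp: pairs_def)
  moreover have "k \<le> Suc n" using assms(3) by simp
  ultimately show ?thesis unfolding allowed_def by blast
qed

lemma allowed_last:
  assumes "F \<subseteq> pairs n" "K \<subseteq> {1..n}"
  shows "allowed (F \<union> K \<times> {Suc n}) (Suc n) \<longleftrightarrow> K = {}"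
proof -
  have "j \<le> n" if "(i, j) \<in> F" for i j using assms(1) that by (auto simp: pairs_def)
  then show ?thesis using assms(2) unfolding allowed_def by fastforce
qed

section \<open>Left-to-right maxima after deletion of the last position\<close>

lemma records_iff: "k \<in> records n s \<longleftrightarrow> k \<in> {1..n} \<and> s (Suc n) < s k \<and> lr_max s k"
  by (auto simp: records_def prev_max_less_iff lr_max_def)

lemma records_subset: "records n s \<subseteq> {1..n}"
  by (auto simp: records_def)

lemma down_le: "k \<in> {1..n} \<Longrightarrow> down n s k \<le> s k"
  by (simp add: down_def)

lemma down_outside: "k \<notin> {1..n} \<Longrightarrow> down n s k = k"
  unfolding down_def by (rule if_not_P)

lemma down_eq: "k \<in> {1..n} \<Longrightarrow> k \<notin> records n s \<Longrightarrow> down n s k = s k"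
  by (simp add: down_def records_def)

text \<open>The recursion of \<open>allowed_Suc\<close> again. At a record \<open>k\<close>, both
  sides hold, since \<open>down n s i \<le> s i \<le> prev_max n s k = down n s k\<close> for
  \<open>i < k\<close>. Elsewhere, values up to \<open>k\<close> are unchanged if no record
  precedes, while a left-to-right maximum after a record is a record.\<close>

lemma lr_max_down:
  assumes s: "s permutes {1..Suc n}" and k: "k \<in> {1..n}"
  shows "lr_max s k \<longleftrightarrow> lr_max (down n s) k \<and> ((\<exists>i \<in> records n s. i < k) \<longrightarrow> k \<in> records n s)"
proof (cases "k \<in> records n s")
  case True
  have "down n s i < down n s k" if i: "i \<in> {1..<k}" for i
  proof -
    have "down n s i \<le> s i" using i k by (intro down_le) auto
    also have "s i \<le> prev_max n s k" using i by (rule le_prev_max)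
    also have "\<dots> = down n s k" using True k by (simp add: records_def down_def)
    finally have "down n s i \<le> down n s k" .
    moreover have "down n s i \<noteq> down n s k"
      using permutes_inj[OF down_permutes[OF s]] i by (auto dest: injD)
    ultimately show ?thesis by simp
  qed
  then show ?thesis using True by (auto simp: records_iff lr_max_def)
next
  case False
  have same: "lr_max (down n s) k \<longleftrightarrow> lr_max s k" if none: "\<not> (\<exists>i \<in> records n s. i < k)"
  proof -
    have "down n s i = s i" if "i \<in> {1..k}" for i
      using that False k none by (intro down_eq) (auto simp: order_le_less)
    then show ?thesis using k by (simp add: lr_max_def)
  qed
  have "\<not> (\<exists>i \<in> records n s. i < k)" if lr: "lr_max s k"
  proof
    assume "\<exists>i \<in> records n s. i < k"
    then obtain i where "i \<in> records n s" "i < k" by blast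
    then have "s (Suc n) < s i" "s i < s k" using lr by (auto simp: records_iff lr_max_def)
    then show False using False lr k by (auto simp: records_iff)
  qed
  then show ?thesis using same False by blast
qed

text \<open>Counterpart of \<open>allowed_last\<close>: the position of the largest value is a
  record unless it is the last position.\<close>

lemma lr_max_last:
  assumes s: "s permutes {1..Suc n}"
  shows "lr_max s (Suc n) \<longleftrightarrow> records n s = {}"
proof
  show "records n s = {}" if lr: "lr_max s (Suc n)"
  proof -
    have "k \<notin> records n s" for k
      using lr by (cases "k \<in> {1..<Suc n}") (auto simp: records_iff lr_max_def dest!: bspec[of _ _ k])
    then show ?thesis by blast
  qed
  assume "records n s = {}"
  have inj: "s i = s j \<longleftrightarrow> i = j" for i j
    using permutes_inj[OF s] by (auto dest: injD)
  have range: "s i \<le> Suc n" if "i \<in> {1..Suc n}" for i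
    using permutes_in_image[OF s, of i] that by simp
  have "Suc n \<in> s ` {1..Suc n}" using permutes_image[OF s] by simp
  then obtain k where k: "k \<in> {1..Suc n}" "s k = Suc n" by (metis imageE)
  have less: "s i < Suc n" if "i \<in> {1..Suc n}" "i \<noteq> k" for i
    using range[OF that(1)] inj[of i k] k that by simp
  have "k = Suc n"
  proof (rule ccontr)
    assume "k \<noteq> Suc n"
    then have "k \<in> records n s" using k less by (auto simp: records_iff lr_max_def)
    then show False using \<open>records n s = {}\<close> by simp
  qed
  then show "lr_max s (Suc n)" using less k by (auto simp: lr_max_def)
qed

text \<open>\<open>allowed\<close> and \<open>lr_max\<close> obey the same recursion; proving both
  claims together makes every record an admissible left end.\<close>

lemma inter_closed_seg:
  assumes "s permutes {1..n}"
  shows "inter_closed (seg n s) \<and> (\<forall>k \<in> {1..n}. allowed (seg n s) k \<longleftrightarrow> lr_max s k)"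
  using assms
proof (induction n arbitrary: s)
  case 0
  then show ?case by (simp add: inter_closed_def)
next
  case (Suc n)
  note IH = Suc.IH[OF down_permutes[OF Suc.prems]]
  note sub = seg_subset_pairs[of n "down n s"] records_subset[of n s]
  have "inter_closed (seg (Suc n) s)"
    unfolding seg.simps inter_closed_Suc[OF sub]
    using IH records_subset[of n s] lr_max_down[OF Suc.prems] by (auto simp: records_iff)
  moreover have "allowed (seg (Suc n) s) k \<longleftrightarrow> lr_max s k" if "k \<in> {1..Suc n}" for k
  proof (cases "k = Suc n")
    case True
    then show ?thesis
      using allowed_last[OF sub] lr_max_last[OF Suc.prems] by simp
  next
    case False
    then have "k \<in> {1..n}" using that by auto
    then show ?thesis
      using allowed_Suc[OF sub, of k] lr_max_down[OF Suc.prems, of k] IH by simp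
  qed
  ultimately show ?case by blast
qed

text \<open>The inverse of \<open>down\<close>: the positions in \<open>K\<close> are inserted in decreasing order, each by swapping its
  value with the last one.\<close>

lemma ex_records_down:
  assumes s': "s' permutes {1..n}" and K: "K \<subseteq> {k \<in> {1..n}. lr_max s' k}"
  shows "\<exists>s. s permutes {1..Suc n} \<and> records n s = K \<and> down n s = s'"
proof -
  have "finite K" using K by (rule finite_subset) simp
  then show ?thesis using K
  proof (induction K rule: finite_linorder_min_induct)
    case empty
    have last: "s' (Suc n) = Suc n" using s' by (simp add: permutes_def)
    have range: "s' i \<le> n" if "i \<in> {1..n}" for i
      using permutes_in_image[OF s', of i] that by simp
    have "k \<notin> records n s'" for k using range[of k] by (auto simp: records_iff last)
    then have "records n s' = {}" by blast
    moreover have "down n s' = s'"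
    proof
      show "down n s' k = s' k" for k
        using down_eq[of k n s'] down_outside[of k n s'] \<open>records n s' = {}\<close>
          permutes_not_in[OF s', of k]
        by (cases "k \<in> {1..n}") simp_all
    qed
    moreover have "s' permutes {1..Suc n}"
      by (rule permutes_subset[OF s']) auto
    ultimately show ?case by blast
  next
    case (insert k K)
    then obtain s where s: "s permutes {1..Suc n}" "records n s = K" "down n s = s'" by auto
    have k: "k \<in> {1..n}" "lr_max s' k" using insert.prems by auto
    \<comment> \<open>As \<open>k\<close> lies below all of \<open>K\<close>, it is a left-to-right
      maximum of \<open>s\<close> but no record, so \<open>s k < s (Suc n)\<close>. The swap makes
      it a record and lowers the last value to \<open>s k\<close>.\<close>
    let ?t = "s \<circ> Transposition.transpose k (Suc n)"
    have t: "?t permutes {1..Suc n}"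
      using s(1) k by (intro permutes_compose permutes_swap_id) auto
    have t_eq: "?t i = s i" if "i \<noteq> k" "i \<noteq> Suc n" for i
      using that by simp
    have t_simp: "?t k = s (Suc n)" "?t (Suc n) = s k" by simp_all
    have not_rec: "i \<notin> records n s" if "i \<le> k" for i using insert.hyps s that by auto
    have low: "s' i = s i" if "i \<in> {1..k}" for i
      using down_eq[of i n s] not_rec[of i] s k that by auto
    have lr: "s i < s k" if "i \<in> {1..<k}" for i
    proof -
      have "s' i < s' k" using k(2) that unfolding lr_max_def by blast
      then show ?thesis using low[of i] low[of k] that k(1) by auto
    qed
    have "s k \<noteq> s (Suc n)" using inj_eq[OF permutes_inj[OF s(1)], of k "Suc n"] k by simp
    moreover have "lr_max s k" unfolding lr_max_def using lr by blast
    ultimately have lt: "s k < s (Suc n)"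
      using not_rec[of k] k(1) unfolding records_iff by linarith
    have pm_low: "prev_max n ?t i = s k" if "i \<in> {1..k}" for i
    proof -
      have "?t ` {1..<i} = s ` {1..<i}" using that k by (intro image_cong t_eq) auto
      then have "prev_max n ?t i = Max (insert (s k) (s ` {1..<i}))"
        by (simp add: prev_max_def)
      also have "\<dots> = s k"
      proof (rule Max_eqI)
        have "s j \<le> s k" if "j \<in> {1..<i}" for j using lr[of j] that \<open>i \<in> {1..k}\<close> by simp
        then show "y \<le> s k" if "y \<in> insert (s k) (s ` {1..<i})" for y using that by auto
      qed auto
      finally show ?thesis .
    qed
    \<comment> \<open>Beyond \<open>k\<close> both swapped values are counted before and after the
      swap.\<close>
    have pm_high: "prev_max n ?t i = prev_max n s i" if "k < i" "i \<in> {1..n}" for i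
    proof -
      define I where "I = {1..<i} - {k}"
      have I: "{1..<i} = insert k I" using that k by (auto simp: I_def)
      have "?t ` I = s ` I" using that by (intro image_cong t_eq) (auto simp: I_def)
      then have "insert (?t (Suc n)) (?t ` {1..<i}) = insert (s (Suc n)) (s ` {1..<i})"
        unfolding I image_insert t_simp by (simp only: insert_commute)
      then show ?thesis by (simp add: prev_max_def)
    qed
    have "i \<in> records n ?t \<longleftrightarrow> i \<in> insert k K" for i
    proof (cases "i \<in> {1..n}")
      case True
      consider "i < k" | "i = k" | "k < i" by linarith
      then show ?thesis
      proof cases
        case 1
        then have "?t i = s i" using True by (intro t_eq) auto
        then show ?thesis
          using 1 True pm_low[of i] lr[of i] not_rec[of i] s(2) by (auto simp: records_def)
      next
        case 2
        then show ?thesis using True pm_low[of i] lt by (auto simp: records_def)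
      next
        case 3
        then have "?t i = s i" using True by (intro t_eq) auto
        then show ?thesis using 3 True pm_high[of i] s(2) by (auto simp: records_def)
      qed
    next
      case False
      then show ?thesis using k insert.prems by (auto simp: records_def)
    qed
    moreover have "down n ?t i = s' i" for i
    proof (cases "i \<in> {1..n}")
      case True
      consider "i < k" | "i = k" | "k < i" by linarith
      then show ?thesis
      proof cases
        case 1
        then have "?t i = s i" using True by (intro t_eq) auto
        then show ?thesis
          using 1 True pm_low[of i] lr[of i] low[of i] by (simp add: down_def)
      next
        case 2
        then show ?thesis using True pm_low[of i] lt low[of i] by (auto simp: down_def)
      next
        case 3
        then have "?t i = s i" using True by (intro t_eq) auto
        then show ?thesis using 3 True pm_high[of i] s(3) by (auto simp: down_def)
      qed
    next
      case False
      then show ?thesis using down_outside permutes_not_in[OF s'] by metis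
    qed
    ultimately show ?case using t by blast
  qed
qed

text \<open>The left ends of the segments ending in \<open>Suc n\<close> are allowed, hence
  left-to-right maxima of the permutation found for the other segments;
  \<open>ex_records_down\<close> turns them into records.\<close>

lemma ex_seg:
  assumes "F \<subseteq> pairs n" "inter_closed F"
  shows "\<exists>s. s permutes {1..n} \<and> seg n s = F"
  using assms
proof (induction n arbitrary: F)
  case 0
  then have "id permutes {1..0::nat} \<and> seg 0 id = F" by (auto simp: pairs_def)
  then show ?case by blast
next
  case (Suc n)
  let ?F = "F \<inter> pairs n" and ?K = "{k. (k, Suc n) \<in> F}"
  have F: "F = ?F \<union> ?K \<times> {Suc n}" using Suc.prems(1) by (auto simp: pairs_Suc)
  have K: "?K \<subseteq> {1..n}" using Suc.prems(1) by (auto simp: pairs_def)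
  have closed: "inter_closed ?F" "\<forall>k \<in> ?K. allowed ?F k"
    using Suc.prems(2) inter_closed_Suc[OF _ K, of ?F] F by auto
  from Suc.IH[OF _ closed(1)] obtain s' where s': "s' permutes {1..n}" "seg n s' = ?F" by auto
  have "?K \<subseteq> {k \<in> {1..n}. lr_max s' k}"
    using inter_closed_seg[OF s'(1)] closed(2) K s'(2) by auto
  from ex_records_down[OF s'(1) this]
  obtain s where s: "s permutes {1..Suc n}" "records n s = ?K" "down n s = s'" by blast
  have "seg (Suc n) s = F" unfolding seg.simps s(2,3) s'(2) using F by (rule sym)
  with s(1) show ?case by blast
qed

section \<open>Existence of flows\<close>

definition height :: "(nat \<Rightarrow> nat) \<Rightarrow> nat \<Rightarrow> real" where
  "height a k = (\<Sum>m = 1..<k. real (a m))"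

text \<open>Such a family is an antichain in the componentwise order, in which Dyck paths are
  chains.\<close>

definition nested :: "(nat \<times> nat) set \<Rightarrow> bool" where
  "nested N \<longleftrightarrow> (\<forall>p \<in> N. \<forall>q \<in> N. p \<noteq> q \<longrightarrow>
     fst p < fst q \<and> snd q < snd p \<or> fst q < fst p \<and> snd p < snd q)"

lemma netflow_add: "netflow n (\<lambda>p. x p + y p) k = netflow n x k + netflow n y k"
  by (simp add: netflow_def sum.distrib)

lemma netflow_sum:
  "netflow n (\<lambda>p. \<Sum>m \<in> I. c m * f m p) k = (\<Sum>m \<in> I. c m * netflow n (f m) k)"
proof -
  have "(\<Sum>p \<in> B. \<Sum>m \<in> I. c m * f m p) = (\<Sum>m \<in> I. c m * sum (f m) B)" for B
    unfolding sum_distrib_left by (rule sum.swap)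
  then show ?thesis
    by (simp add: netflow_def sum_subtractf right_diff_distrib)
qed

lemma netflow_single:
  assumes "(b, e) \<in> pairs n"
  shows "netflow n (indicator {(b, e)}) k = of_bool (k = e) - of_bool (k = b)"
proof -
  have fin: "finite {p \<in> pairs n. P p}" for P using finite_pairs[of n] by simp
  have "sum (indicator {(b, e)}) {p \<in> pairs n. g p = k} = (of_bool (g (b, e) = k) :: real)"
    for g :: "nat \<times> nat \<Rightarrow> nat"
    using fin assms by (simp add: indicator_def of_bool_def)
  then show ?thesis by (auto simp: netflow_def)
qed

text \<open>\<open>N\<close> collects the pairs \<open>(b, e)\<close> of the peeling of
  \<open>A\<close>; a unit flow along each of them undoes one exchange.\<close>

lemma ex_nested_matching:
  assumes "A \<subseteq> {1..n}"
  shows "\<exists>N. N \<subseteq> cut n A \<and> nested N \<and> (\<forall>(p, q) \<in> N. p \<le> card A \<and> card A < q) \<and>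
    (\<forall>k \<in> {1..n}. netflow n (indicator N) k = of_bool (k \<in> A) - of_bool (k \<le> card A))"
  using assms
proof (induction rule: peel_induct)
  case (initial m)
  show ?case by (intro exI[of _ "{}"]) (auto simp: nested_def netflow_def)
next
  case (peel A b e)
  let ?A = "insert b (A - {e})"
  have fin: "finite A" using peel.hyps(1) finite_subset by blast
  have card: "card ?A = card A" using card_insert_diff[OF fin peel.hyps(4,5)] .
  obtain N where N: "N \<subseteq> cut n ?A" "nested N" "\<And>p q. (p, q) \<in> N \<Longrightarrow> p \<le> card A \<and> card A < q"
    "\<And>k. k \<in> {1..n} \<Longrightarrow> netflow n (indicator N) k = of_bool (k \<in> ?A) - of_bool (k \<le> card A)"
    using peel.IH unfolding card by blast
  have be: "(b, e) \<in> pairs n" using peel.hyps by (auto simp: pairs_def)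
  \<comment> \<open>Arcs entering the exchanged set lie strictly between \<open>b\<close> and
    \<open>e\<close>, which gives the nesting.\<close>
  have inner: "b < p \<and> p < q \<and> q < e \<and> (p, q) \<in> cut n A" if "(p, q) \<in> N" for p q
  proof -
    have *: "(p, q) \<in> pairs n" "p \<noteq> b" "p \<notin> A - {e}" "q = b \<or> q \<in> A \<and> q \<noteq> e"
      using N(1) that by (auto simp: cut_def)
    then have "q < e" using peel.hyps(6,7) by (auto simp: order_less_le)
    moreover have "p < q" "1 \<le> p" using *(1) by (auto simp: pairs_def)
    ultimately have "p \<notin> A" using *(3) by auto
    then have "\<not> p < b" using peel.hyps(3) \<open>1 \<le> p\<close> by auto
    then have "b < p" using *(2) by simp
    then show ?thesis using * \<open>p \<notin> A\<close> \<open>p < q\<close> \<open>q < e\<close> by (auto simp: cut_def)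
  qed
  then have notin: "(b, e) \<notin> N" by blast
  \<comment> \<open>Counting \<open>insert e {1..<b} \<subseteq> A \<subseteq> {1..e} - {b}\<close>
    gives \<open>b \<le> card A < e\<close>.\<close>
  have "insert e {1..<b} \<subseteq> A" using peel.hyps by auto
  from card_mono[OF fin this] have b: "b \<le> card A" using peel.hyps by simp
  have "A \<subseteq> {1..e} - {b}" using peel.hyps(1,4,6) by force
  from card_mono[OF _ this] have e: "card A < e" using peel.hyps by simp
  show ?case
  proof (intro exI[of _ "insert (b, e) N"] conjI ballI)
    show "insert (b, e) N \<subseteq> cut n A" using inner be peel.hyps by (auto simp: cut_def)
    show "nested (insert (b, e) N)" using N(2) inner by (fastforce simp: nested_def)
    show "case p of (p, q) \<Rightarrow> p \<le> card A \<and> card A < q" if "p \<in> insert (b, e) N" for p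
      using that b e N(3) by auto
    fix k assume k: "k \<in> {1..n}"
    have "indicator (insert (b, e) N) = (\<lambda>p. indicator {(b, e)} p + indicator N p :: real)"
      using notin by (auto simp: indicator_def fun_eq_iff)
    then have "netflow n (indicator (insert (b, e) N)) k =
        of_bool (k = e) - of_bool (k = b) + (of_bool (k \<in> ?A) - of_bool (k \<le> card A))"
      by (simp only: netflow_add netflow_single[OF be] N(4)[OF k])
    also have "\<dots> = of_bool (k \<in> A) - of_bool (k \<le> card A)"
      using peel.hyps(4,5,7) by auto
    finally show "netflow n (indicator (insert (b, e) N)) k =
      of_bool (k \<in> A) - of_bool (k \<le> card A)" .
  qed
qed

section \<open>Dyck paths against nested families\<close>

lemma dyck_path_mono:
  assumes "dyck_path n d" "i \<le> j" "j < length d"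
  shows "fst (d ! i) \<le> fst (d ! j)" "snd (d ! i) \<le> snd (d ! j)"
    "fst (d ! j) + snd (d ! j) = fst (d ! i) + snd (d ! i) + (j - i)"
proof -
  have "fst (d ! i) \<le> fst (d ! j) \<and> snd (d ! i) \<le> snd (d ! j) \<and>
      fst (d ! j) + snd (d ! j) = fst (d ! i) + snd (d ! i) + (j - i)"
    using assms(2,3)
  proof (induction rule: dec_induct)
    case (step j)
    then have "d ! (j + 1) = (fst (d ! j) + 1, snd (d ! j)) \<or>
        d ! (j + 1) = (fst (d ! j), snd (d ! j) + 1)"
      using assms(1) by (simp add: dyck_path_def)
    then show ?case using step by auto
  qed simp
  then show "fst (d ! i) \<le> fst (d ! j)" "snd (d ! i) \<le> snd (d ! j)"
    "fst (d ! j) + snd (d ! j) = fst (d ! i) + snd (d ! i) + (j - i)" by auto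
qed

lemma dyck_path_distinct: "dyck_path n d \<Longrightarrow> distinct d"
  unfolding distinct_conv_nth
  using dyck_path_mono(3)[of n d]
  by (metis add_cancel_right_right diff_is_0_eq linorder_le_cases order_antisym)

text \<open>A chain and an antichain share at most one pair \<open>(p, q)\<close>. If they share
  one, then \<open>fst (hd d) \<le> p \<le> m < q \<le> fst (last d) + 1\<close>.\<close>

lemma dyck_path_nested:
  assumes d: "dyck_path n d" and N: "nested N" "\<And>p q. (p, q) \<in> N \<Longrightarrow> p \<le> m \<and> m < q"
  shows "(\<Sum>p\<leftarrow>d. indicator N p) \<le> (of_bool (fst (hd d) \<le> m \<and> m \<le> fst (last d)) :: real)"
proof -
  have sum: "(\<Sum>p\<leftarrow>d. indicator N p) = real (card (set d \<inter> N))"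
    using dyck_path_distinct[OF d]
    by (simp add: sum_list_distinct_conv_sum_set sum.inter_restrict[symmetric] indicator_def Int_def)
  show ?thesis
  proof (cases "set d \<inter> N = {}")
    case True
    then show ?thesis using sum by simp
  next
    case False
    then obtain p where p: "p \<in> set d" "p \<in> N" by blast
    then obtain i where i: "i < length d" "d ! i = p" by (auto simp: in_set_conv_nth)
    have "q = p" if q: "q \<in> set d" "q \<in> N" for q
    proof (rule ccontr)
      assume "q \<noteq> p"
      obtain j where j: "j < length d" "d ! j = q" using q(1) by (auto simp: in_set_conv_nth)
      have "fst p < fst q \<and> snd q < snd p \<or> fst q < fst p \<and> snd p < snd q"
        using N(1) p(2) q(2) \<open>q \<noteq> p\<close> unfolding nested_def by blast
      then show False
        using dyck_path_mono(1,2)[OF d, of i j] dyck_path_mono(1,2)[OF d, of j i] i j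
        by (cases "i \<le> j") auto
    qed
    then have "set d \<inter> N = {p}" using p by blast
    moreover have "d \<noteq> []" "snd (last d) = fst (last d) + 1"
      using d by (auto simp: dyck_path_def)
    moreover have "fst (d ! 0) \<le> fst p" "snd p \<le> snd (d ! (length d - 1))"
      using dyck_path_mono(1)[OF d, of 0 i] dyck_path_mono(2)[OF d, of i "length d - 1"] i by auto
    moreover have "fst p \<le> m" "m < snd p" using N(2)[of "fst p" "snd p"] p by auto
    ultimately show ?thesis using sum by (simp add: hd_conv_nth last_conv_nth)
  qed
qed

lemma height_eq_sum:
  assumes "k \<le> n"
  shows "height a k = (\<Sum>m = 1..<n. real (a m) * of_bool (m < k))"
proof -
  have "{1..<k} = {1..<n} \<inter> {m. m < k}" using assms by auto
  then show ?thesis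
    by (simp add: height_def sum.inter_restrict of_bool_def if_distrib cong: if_cong)
qed

text \<open>The point is built in layers, one per fundamental weight: layer \<open>m\<close> is the
  nested matching for the sublevel set of level \<open>m\<close>, taken \<open>a m\<close> times. A
  Dyck path meets layer \<open>m\<close> at most once, and only if \<open>a m\<close> is a summand
  of \<open>M a d\<close>.\<close>

lemma ex_lattice_flow:
  assumes s: "s permutes {1..n}"
  shows "\<exists>T \<in> FFLV_lattice_points n a. \<forall>k \<in> {1..n}.
    netflow n (Poly_Mapping.lookup T) k = height a k - height a (s k)"
proof -
  let ?P = "\<lambda>m N. N \<subseteq> pairs n \<and> nested N \<and> (\<forall>(p, q) \<in> N. p \<le> m \<and> m < q) \<and>
      (\<forall>k \<in> {1..n}. netflow n (indicator N) k = of_bool (s k \<le> m) - of_bool (k \<le> m))"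
  have "\<exists>N. ?P m N" if "m \<in> {1..<n}" for m
  proof -
    have m: "m \<le> n" using that by simp
    have mem: "k \<in> sublevel n s m \<longleftrightarrow> s k \<le> m" if "k \<in> {1..n}" for k
      using that by (auto simp: sublevel_def)
    from ex_nested_matching[OF sublevel_subset[of n s m]]
    obtain N where "N \<subseteq> cut n (sublevel n s m)" "nested N" "\<forall>(p, q) \<in> N. p \<le> m \<and> m < q"
      "\<forall>k \<in> {1..n}. netflow n (indicator N) k = of_bool (k \<in> sublevel n s m) - of_bool (k \<le> m)"
      unfolding sum_sublevel(2)[OF s m] by blast
    then have "?P m N" using mem by (auto simp: cut_def)
    then show ?thesis by blast
  qed
  then have "\<forall>m \<in> {1..<n}. \<exists>N. ?P m N" by blast
  from bchoice[OF this] obtain N where N': "\<forall>m \<in> {1..<n}. ?P m (N m)" by blast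
  have N: "N m \<subseteq> pairs n" "nested (N m)" "\<And>p q. (p, q) \<in> N m \<Longrightarrow> p \<le> m \<and> m < q"
    "\<And>k. k \<in> {1..n} \<Longrightarrow>
      netflow n (indicator (N m)) k = of_bool (s k \<le> m) - of_bool (k \<le> m)"
    if "m \<in> {1..<n}" for m
    using N' that by blast+
  let ?f = "\<lambda>p. \<Sum>m = 1..<n. real (a m) * indicator (N m) p"
  have out: "?f p = 0" if "p \<notin> pairs n" for p
  proof (intro sum.neutral ballI)
    show "real (a m) * indicator (N m) p = 0" if "m \<in> {1..<n}" for m
      using N(1)[OF that] \<open>p \<notin> pairs n\<close> by (auto simp: indicator_def)
  qed
  then have "finite {p. ?f p \<noteq> 0}"
    by (intro finite_subset[OF _ finite_pairs[of n]]) blast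
  then have T: "Poly_Mapping.lookup (Abs_poly_mapping ?f) = ?f" by simp
  define T where "T = Abs_poly_mapping ?f"
  note T = T[folded T_def]
  have "netflow n (Poly_Mapping.lookup T) k = height a k - height a (s k)" if k: "k \<in> {1..n}" for k
  proof -
    have "s k \<in> {1..n}" using permutes_in_image[OF s] k by simp
    have "netflow n ?f k = (\<Sum>m = 1..<n. real (a m) * (of_bool (s k \<le> m) - of_bool (k \<le> m)))"
      unfolding netflow_sum using N(4) k by (intro sum.cong) simp_all
    also have "\<dots> = (\<Sum>m = 1..<n. real (a m) * of_bool (m < k) - real (a m) * of_bool (m < s k))"
      by (intro sum.cong) (auto simp: not_le)
    also have "\<dots> = height a k - height a (s k)"
      using k \<open>s k \<in> _\<close> by (simp add: sum_subtractf height_eq_sum[of _ n])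
    finally show ?thesis unfolding T .
  qed
  moreover have "S T d \<le> M a d" if d: "dyck_path n d" for d
  proof -
    have "last d \<in> set d" "set d \<subseteq> pairs n" "hd d \<in> set d" "snd (last d) = fst (last d) + 1"
      using d by (auto simp: dyck_path_def)
    then have "hd d \<in> pairs n" "last d \<in> pairs n" by auto
    then have ends: "1 \<le> fst (hd d)" "fst (last d) < n"
      by (auto simp: pairs_def case_prod_beta)
    have "S T d = (\<Sum>m = 1..<n. real (a m) * (\<Sum>p\<leftarrow>d. indicator (N m) p))"
      unfolding S_def T by (induction d) (auto simp: sum.distrib distrib_left)
    also have "\<dots> \<le> (\<Sum>m = 1..<n. real (a m) * of_bool (fst (hd d) \<le> m \<and> m \<le> fst (last d)))"
      using dyck_path_nested[OF d N(2) N(3)] by (intro sum_mono mult_left_mono) auto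
    also have "\<dots> = (\<Sum>m \<in> {1..<n} \<inter> {fst (hd d)..fst (last d)}. real (a m))"
      by (simp add: sum.inter_restrict of_bool_def if_distrib cong: if_cong)
    also have "{1..<n} \<inter> {fst (hd d)..fst (last d)} = {fst (hd d)..fst (last d)}"
      using ends by auto
    finally show ?thesis by (simp add: M_def)
  qed
  moreover have "T \<in> U n"
    unfolding U_def
  proof (intro CollectI subsetI)
    fix p assume "p \<in> Poly_Mapping.keys T"
    then have "?f p \<noteq> 0" by (simp only: in_keys_iff T not_False_eq_True)
    then show "p \<in> pairs n" using out[of p] by (rule contrapos_np)
  qed
  moreover have "0 \<le> ?f p" "?f p \<in> \<int>" for p
    by (auto intro!: sum_nonneg Ints_sum Ints_mult simp: indicator_def)
  ultimately have "T \<in> FFLV_lattice_points n a" "\<forall>k \<in> {1..n}.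
      netflow n (Poly_Mapping.lookup T) k = height a k - height a (s k)"
    by (simp_all only: FFLV_lattice_points_def FFLV_polytope_def T mem_Collect_eq) simp_all
  then show ?thesis by blast
qed

section \<open>Weights\<close>

lemma lookup_eps:
  assumes "1 \<le> i"
  shows "Poly_Mapping.lookup (eps n i) k =
    (if 1 \<le> k \<and> k < n then of_bool (i = k) - of_bool (i = Suc k) else 0)"
  using assms
  by (cases i) (auto simp: eps_def fund_weight_def lookup_minus lookup_single when_def)

lemma lookup_sum_eps:
  "Poly_Mapping.lookup (\<Sum>i = 1..n. c i *\<^sub>R eps n i) k =
    (if 1 \<le> k \<and> k < n then c k - c (Suc k) else 0)"
proof -
  have "Poly_Mapping.lookup (\<Sum>i = 1..n. c i *\<^sub>R eps n i) k =
      (\<Sum>i = 1..n. c i * Poly_Mapping.lookup (eps n i) k)"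
    by (simp add: lookup_sum lookup_scaleR_point)
  also have "\<dots> = (\<Sum>i = 1..n. if 1 \<le> k \<and> k < n then
      (if i = k then c i else 0) - (if i = Suc k then c i else 0) else 0)"
    by (intro sum.cong) (auto simp: lookup_eps)
  also have "\<dots> = (if 1 \<le> k \<and> k < n then c k - c (Suc k) else 0)"
    by (auto simp: sum_subtractf)
  finally show ?thesis .
qed

text \<open>Comparing coordinates shows that \<open>c - d\<close> is constant, reflecting the
  relation that all \<open>eps n i\<close> add up to zero; equal totals make the constant
  zero.\<close>

lemma sum_eps_eq_iff:
  assumes "sum c {1..n} = sum d {1..n}"
  shows "(\<Sum>i = 1..n. c i *\<^sub>R eps n i) = (\<Sum>i = 1..n. d i *\<^sub>R eps n i) \<longleftrightarrow>
    (\<forall>k \<in> {1..n}. c k = d k)"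
proof
  assume eq: "(\<Sum>i = 1..n. c i *\<^sub>R eps n i) = (\<Sum>i = 1..n. d i *\<^sub>R eps n i)"
  have Suc_eq: "c k - d k = c (Suc k) - d (Suc k)" if "1 \<le> k" "k < n" for k
    using arg_cong[OF eq, of "\<lambda>\<mu>. Poly_Mapping.lookup \<mu> k"] that unfolding lookup_sum_eps by simp
  have const: "c k - d k = c 1 - d 1" if "1 \<le> k" "k \<le> n" for k
    using that(1,2)
  proof (induction k rule: dec_induct)
    case (step k)
    then show ?case using Suc_eq[of k] by simp
  qed simp
  have "0 = (\<Sum>k = 1..n. c k - d k)" using assms by (simp add: sum_subtractf)
  also have "\<dots> = (\<Sum>k = 1..n. c 1 - d 1)" by (intro sum.cong const) auto
  finally have zero: "n = 0 \<or> c 1 = d 1" by simp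
  show "\<forall>k \<in> {1..n}. c k = d k"
  proof
    show "c k = d k" if "k \<in> {1..n}" for k using const[of k] zero that by auto
  qed
qed simp

lemma pos_root_eq: "i \<le> j \<Longrightarrow> pos_root n i j = eps n i - eps n j"
  using sum_Suc_diff'[of i j "\<lambda>k. - eps n k"] by (simp add: pos_root_def simple_root_def)

lemma lookup_highest_weight:
  "Poly_Mapping.lookup (highest_weight n a) k = (if 1 \<le> k \<and> k < n then real (a k) else 0)"
proof -
  have "Poly_Mapping.lookup (highest_weight n a) k =
      (\<Sum>i = 1..<n. real (a i) * Poly_Mapping.lookup (fund_weight n i) k)"
    by (simp add: highest_weight_def lookup_sum lookup_scaleR_point)
  also have "\<dots> = (\<Sum>i = 1..<n. if i = k then real (a i) else 0)"
    by (intro sum.cong) (auto simp: fund_weight_def lookup_single when_def)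
  also have "\<dots> = (if 1 \<le> k \<and> k < n then real (a k) else 0)" by simp
  finally show ?thesis .
qed

lemma height_Suc: "1 \<le> k \<Longrightarrow> height a (Suc k) = height a k + real (a k)"
  by (simp add: height_def)

lemma sum_eq_height_diff:
  assumes "1 \<le> i" "i \<le> j"
  shows "(\<Sum>k = i..<j. real (a k)) = height a j - height a i"
  using sum.atLeastLessThan_concat[OF assms, of "\<lambda>k. real (a k)"] by (simp add: height_def)

lemma highest_weight_eps:
  "highest_weight n a = (\<Sum>i = 1..n. (height a n - height a i) *\<^sub>R eps n i)"
  by (rule poly_mapping_eqI, unfold lookup_sum_eps lookup_highest_weight) (simp add: height_Suc)

text \<open>Reindexing by \<open>k = w i\<close> brings in \<open>inv w\<close>.\<close>

lemma weyl_act_highest_weight: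
  assumes w: "w permutes {1..n}"
  shows "weyl_act n w (highest_weight n a) =
    (\<Sum>k = 1..n. (height a n - height a (inv w k)) *\<^sub>R eps n k)"
proof -
  have "weyl_act n w (highest_weight n a) = (\<Sum>i = 1..n. (height a n - height a i) *\<^sub>R eps n (w i))"
    unfolding weyl_act_def
  proof (intro sum.cong refl arg_cong2[of _ _ _ _ "scaleR"])
    fix i assume i: "i \<in> {1..n}"
    have "(\<Sum>k = i..<n. Poly_Mapping.lookup (highest_weight n a) k) = (\<Sum>k = i..<n. real (a k))"
      using i by (intro sum.cong) (auto simp: lookup_highest_weight)
    also have "\<dots> = height a n - height a i" using i by (intro sum_eq_height_diff) auto
    finally show "(\<Sum>k = i..<n. Poly_Mapping.lookup (highest_weight n a) k) =
      height a n - height a i" .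
  qed
  also have "\<dots> = (\<Sum>i = 1..n. (height a n - height a (inv w (w i))) *\<^sub>R eps n (w i))"
    by (simp add: permutes_inverses[OF w])
  also have "\<dots> = (\<Sum>k = 1..n. (height a n - height a (inv w k)) *\<^sub>R eps n k)"
    using sum.permute[OF w, of "\<lambda>k. (height a n - height a (inv w k)) *\<^sub>R eps n k"] by (simp add: o_def)
  finally show ?thesis .
qed

text \<open>A root is \<open>eps n i - eps n j\<close>, so subtracting a multiple of it moves that
  amount from \<open>i\<close> to \<open>j\<close>.\<close>

lemma point_weight_eps:
  "point_weight n a T =
    (\<Sum>k = 1..n. (height a n - height a k + netflow n (Poly_Mapping.lookup T) k) *\<^sub>R eps n k)"
proof -
  let ?x = "Poly_Mapping.lookup T"
  have group: "(\<Sum>p \<in> pairs n. ?x p *\<^sub>R eps n (g p)) =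
      (\<Sum>k = 1..n. sum ?x {p \<in> pairs n. g p = k} *\<^sub>R eps n k)" if "g ` pairs n \<subseteq> {1..n}" for g
  proof -
    have "(\<Sum>k = 1..n. sum ?x {p \<in> pairs n. g p = k} *\<^sub>R eps n k) =
        (\<Sum>k = 1..n. \<Sum>p \<in> {p \<in> pairs n. g p = k}. ?x p *\<^sub>R eps n (g p))"
      by (simp add: scaleR_sum_left)
    also have "\<dots> = (\<Sum>p \<in> pairs n. ?x p *\<^sub>R eps n (g p))"
      using that finite_pairs[of n] by (intro sum.group) auto
    finally show ?thesis by simp
  qed
  have "(\<Sum>(i, j) \<in> pairs n. ?x (i, j) *\<^sub>R pos_root n i j) =
      (\<Sum>p \<in> pairs n. ?x p *\<^sub>R eps n (fst p) - ?x p *\<^sub>R eps n (snd p))"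
    by (intro sum.cong) (auto simp: pairs_def pos_root_eq scaleR_diff_right)
  also have "\<dots> = (\<Sum>k = 1..n. sum ?x {p \<in> pairs n. fst p = k} *\<^sub>R eps n k) -
      (\<Sum>k = 1..n. sum ?x {p \<in> pairs n. snd p = k} *\<^sub>R eps n k)"
    unfolding sum_subtractf by (intro arg_cong2[of _ _ _ _ "(-)"] group) (auto simp: pairs_def)
  also have "\<dots> = - (\<Sum>k = 1..n. netflow n ?x k *\<^sub>R eps n k)"
    by (simp add: netflow_def scaleR_diff_left sum_subtractf)
  finally show ?thesis
    by (simp add: point_weight_def highest_weight_eps scaleR_add_left sum.distrib)
qed

text \<open>Net flows cancel in total and \<open>inv w\<close> only permutes the heights, so both
  coefficient vectors have the same sum and \<open>sum_eps_eq_iff\<close> applies.\<close>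

lemma point_weight_eq_iff:
  assumes w: "w permutes {1..n}"
  shows "point_weight n a T = weyl_act n w (highest_weight n a) \<longleftrightarrow>
    (\<forall>k \<in> {1..n}. netflow n (Poly_Mapping.lookup T) k = height a k - height a (inv w k))"
proof -
  have "cut n {1..n} = {}" "cut n {} = {}" by (auto simp: cut_def pairs_def)
  then have "(\<Sum>k = 1..n. netflow n (Poly_Mapping.lookup T) k) = 0"
    using sum_netflow[of "{1..n}" n] by simp
  moreover have "(\<Sum>k = 1..n. height a (inv w k)) = (\<Sum>k = 1..n. height a k)"
    using sum.permute[OF permutes_inv[OF w], of "height a"] by (simp add: o_def)
  ultimately have "(\<Sum>k = 1..n. height a n - height a k + netflow n (Poly_Mapping.lookup T) k) =
      (\<Sum>k = 1..n. height a n - height a (inv w k))"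
    by (simp add: sum.distrib sum_subtractf)
  from sum_eps_eq_iff[OF this] show ?thesis
    unfolding point_weight_eps weyl_act_highest_weight[OF w] by (auto simp: algebra_simps)
qed

section \<open>Extremal points\<close>

lemma set_corner_path:
  assumes "i < j"
  shows "set (corner_path i j) = hook i j" "distinct (corner_path i j)"
  using assms by (auto simp: corner_path_def hook_def distinct_map inj_on_def)

lemma S_corner_path_hook: "i < j \<Longrightarrow> S x (corner_path i j) = sum (Poly_Mapping.lookup x) (hook i j)"
  by (simp add: S_def sum_list_distinct_conv_sum_set set_corner_path)

lemma nth_corner_path:
  assumes "i < j" "k < 2 * (j - i) - 1"
  shows "corner_path i j ! k = (if k < j - i then (i, i + 1 + k) else (k + 2 * i + 1 - j, j))"
  using assms by (auto simp: corner_path_def nth_append)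

lemma length_corner_path: "i < j \<Longrightarrow> length (corner_path i j) = 2 * (j - i) - 1"
  by (simp add: corner_path_def)

lemma corner_path_ends:
  assumes "i < j"
  shows "hd (corner_path i j) = (i, i + 1)" "last (corner_path i j) = (j - 1, j)"
proof -
  have ne: "corner_path i j \<noteq> []" using length_corner_path[OF assms] assms by auto
  show "hd (corner_path i j) = (i, i + 1)"
    using assms by (simp add: hd_conv_nth[OF ne] nth_corner_path)
  show "last (corner_path i j) = (j - 1, j)"
    using assms by (auto simp: last_conv_nth[OF ne] length_corner_path nth_corner_path)
qed

lemma dyck_path_corner_path:
  assumes "(i, j) \<in> pairs n"
  shows "dyck_path n (corner_path i j)"
proof -
  have ij: "i < j" using assms by (simp add: pairs_def)
  have "corner_path i j ! (k + 1) = (fst (corner_path i j ! k) + 1, snd (corner_path i j ! k)) \<or>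
      corner_path i j ! (k + 1) = (fst (corner_path i j ! k), snd (corner_path i j ! k) + 1)"
    if "k + 1 < length (corner_path i j)" for k
    using that ij by (auto simp: length_corner_path nth_corner_path)
  moreover have "corner_path i j \<noteq> []" using length_corner_path[OF ij] ij by auto
  ultimately show ?thesis
    using corner_path_ends[OF ij] set_corner_path[OF ij] hook_subset_pairs[OF assms] ij
    by (auto simp: dyck_path_def)
qed

lemma lookup_in_hook_polytope:
  assumes x: "x \<in> FFLV_polytope n a"
  shows "Poly_Mapping.lookup x \<in> hook_polytope n (height a)"
proof -
  have "sum (Poly_Mapping.lookup x) (hook i j) \<le> height a j - height a i" if "(i, j) \<in> pairs n" for i j
  proof -
    have ij: "1 \<le> i" "i < j" using that by (auto simp: pairs_def)
    have "{i..j - 1} = {i..<j}" using ij by auto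
    then have "M a (corner_path i j) = height a j - height a i"
      using sum_eq_height_diff[of i j a] ij by (simp add: M_def corner_path_ends)
    then show ?thesis
      using x dyck_path_corner_path[OF that] S_corner_path_hook[OF ij(2), of x]
      by (auto simp: FFLV_polytope_def)
  qed
  then show ?thesis using x by (auto simp: hook_polytope_def FFLV_polytope_def)
qed

lemma flow_lookup:
  assumes "x \<in> FFLV_polytope n a" "s permutes {1..n}"
    "\<forall>k \<in> {1..n}. netflow n (Poly_Mapping.lookup x) k = height a k - height a (s k)"
  shows "flow n (height a) (Poly_Mapping.lookup x) s"
  using assms lookup_in_hook_polytope by unfold_locales auto

section \<open>From pairs to segments\<close>

definition segs :: "(nat \<times> nat) set \<Rightarrow> nat set set" where
  "segs F = (\<lambda>(i, j). {i..j}) ` F"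

lemma mem_segs_iff:
  assumes "i \<le> j"
  shows "{i..j} \<in> segs F \<longleftrightarrow> (i, j) \<in> F"
proof
  assume "{i..j} \<in> segs F"
  then obtain i' j' where "(i', j') \<in> F" "{i..j} = {i'..j'}" by (auto simp: segs_def)
  then show "(i, j) \<in> F" using assms by (simp add: Icc_eq_Icc)
qed (auto simp: segs_def)

text \<open>\<open>flow_seg\<close> supplies the equations of \<open>x(E)\<close>, which have a
  unique solution; so \<open>s\<close> alone determines the flow.\<close>

lemma segment_point_eqI:
  assumes x: "x \<in> FFLV_polytope n a" and fl: "flow n (height a) (Poly_Mapping.lookup x) s"
  shows "segment_point n a (segs (seg n s)) = x"
proof -
  have "is_segment_point n a (segs (seg n s)) x"
    unfolding is_segment_point_def
  proof (intro conjI ballI)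
    show "x \<in> U n" using x by (simp add: FFLV_polytope_def)
    fix p assume "p \<in> pairs n"
    then obtain i j where p: "p = (i, j)" and ij: "(i, j) \<in> pairs n" by (cases p) auto
    have lt: "1 \<le> i" "i < j" using ij by (auto simp: pairs_def)
    show "case p of (i, j) \<Rightarrow>
        ({i..j} \<notin> segs (seg n s) \<longrightarrow> Poly_Mapping.lookup x (i, j) = 0) \<and>
        ({i..j} \<in> segs (seg n s) \<longrightarrow> S x (corner_path i j) = (\<Sum>k = i..<j. real (a k)))"
      using flow_seg[OF fl ij] mem_segs_iff[OF less_imp_le[OF lt(2)]] lt
      by (simp add: p S_corner_path_hook sum_eq_height_diff)
  qed
  then show ?thesis
    unfolding segment_point_def by (intro the1_equality ex1_segment_point)
qed

lemma extremal_point_props: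
  assumes w: "w permutes {1..n}"
  shows "extremal_point n a w \<in> FFLV_polytope n a"
    and "flow n (height a) (Poly_Mapping.lookup (extremal_point n a w)) (inv w)"
    and "extremal_point n a w = segment_point n a (segs (seg n (inv w)))"
proof -
  let ?E = "extremal_point n a w" and ?P = "segment_point n a (segs (seg n (inv w)))"
  note inv = permutes_inv[OF w]
  \<comment> \<open>All candidates equal one segment point; with \<open>ex_lattice_flow\<close> this
    makes the definite description meaningful.\<close>
  have unique: "T = ?P" if "T \<in> FFLV_lattice_points n a"
    "point_weight n a T = weyl_act n w (highest_weight n a)" for T
  proof -
    have T: "T \<in> FFLV_polytope n a" using that(1) by (simp add: FFLV_lattice_points_def)
    from segment_point_eqI[OF T flow_lookup[OF T inv]] show ?thesis
      using that(2) point_weight_eq_iff[OF w] by simp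
  qed
  obtain T where T: "T \<in> FFLV_lattice_points n a"
    "\<forall>k \<in> {1..n}. netflow n (Poly_Mapping.lookup T) k = height a k - height a (inv w k)"
    using ex_lattice_flow[OF inv] by blast
  then have wt: "point_weight n a T = weyl_act n w (highest_weight n a)"
    using point_weight_eq_iff[OF w] by blast
  have "?E = T"
    unfolding extremal_point_def using T(1) wt unique by (intro the_equality) auto
  moreover have TP: "T \<in> FFLV_polytope n a" using T(1) by (simp add: FFLV_lattice_points_def)
  ultimately show "?E \<in> FFLV_polytope n a" "flow n (height a) (Poly_Mapping.lookup ?E) (inv w)"
    "?E = ?P"
    using flow_lookup[OF TP inv T(2)] unique[OF T(1) wt] by simp_all
qed

section \<open>Inequalities that are tight at extremal points\<close>

lemma sum_netflow_sublevel_le: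
  assumes x: "x \<in> hook_polytope n h" and s: "s permutes {1..n}" and m: "m \<le> n"
  shows "(\<Sum>k \<in> sublevel n s m. netflow n x k) \<le> (\<Sum>k \<in> sublevel n s m. h k - h (s k))"
proof -
  let ?A = "sublevel n s m"
  have "0 \<le> sum x (cut n ({1..n} - ?A))"
    using x by (intro sum_nonneg) (auto simp: hook_polytope_def cut_def)
  then have "(\<Sum>k \<in> ?A. netflow n x k) \<le> sum x (cut n ?A)"
    by (simp add: sum_netflow[OF sublevel_subset])
  also have "\<dots> \<le> sum h ?A - sum h {1..card ?A}"
    using x sublevel_subset by (rule sum_cut_le)
  also have "\<dots> = (\<Sum>k \<in> ?A. h k - h (s k))"
    by (simp add: sum_subtractf sum_sublevel[OF s m])
  finally show ?thesis .
qed

text \<open>The sublevel sets of levels \<open>s k - 1\<close> and \<open>s k\<close> differ exactly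
  by \<open>k\<close>.\<close>

lemma eq_on_if_sums_sublevel_eq:
  fixes f g :: "nat \<Rightarrow> real"
  assumes s: "s permutes {1..n}" and k: "k \<in> {1..n}"
    and eq: "\<And>m. m \<le> n \<Longrightarrow> sum f (sublevel n s m) = sum g (sublevel n s m)"
  shows "f k = g k"
proof -
  have sk: "1 \<le> s k" "s k \<le> n" using permutes_in_image[OF s, of k] k by auto
  have "s j \<le> s k \<longleftrightarrow> j = k \<or> s j \<le> s k - 1" for j
    using inj_eq[OF permutes_inj[OF s], of j k] sk by (cases "j = k") auto
  then have "sublevel n s (s k) = insert k (sublevel n s (s k - 1))"
    using k by (auto simp: sublevel_def)
  moreover have "k \<notin> sublevel n s (s k - 1)" using sk by (auto simp: sublevel_def)
  moreover have "finite (sublevel n s (s k - 1))" by (simp add: sublevel_def)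
  ultimately show ?thesis using eq[of "s k"] eq[of "s k - 1"] sk by simp
qed

text \<open>At an extremal point the sums of \<open>netflow\<close> over the sublevel sets of \<open>inv w\<close> attain their
  maxima over the polytope, and these sums determine the flow.\<close>

lemma extreme_point_extremal_point:
  assumes w: "w permutes {1..n}"
  shows "extremal_point n a w extreme_point_of FFLV_polytope n a"
  unfolding extreme_point_of_def
proof (intro conjI ballI notI)
  let ?T = "extremal_point n a w" and ?s = "inv w" and ?h = "height a"
  let ?f = "\<lambda>x. netflow n (Poly_Mapping.lookup x)"
  note props = extremal_point_props[OF w, of a]
  note inv = permutes_inv[OF w]
  show "?T \<in> FFLV_polytope n a" by (rule props)
  fix y z assume y: "y \<in> FFLV_polytope n a" and z: "z \<in> FFLV_polytope n a"
    and T: "?T \<in> open_segment y z"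
  then obtain u where "y \<noteq> z" and u: "0 < u" "u < 1" "?T = (1 - u) *\<^sub>R y + u *\<^sub>R z"
    by (auto simp: in_segment)
  have lin: "?f ?T k = (1 - u) * ?f y k + u * ?f z k" for k
  proof -
    have sums: "sum (Poly_Mapping.lookup ?T) B =
        (1 - u) * sum (Poly_Mapping.lookup y) B + u * sum (Poly_Mapping.lookup z) B" for B
      unfolding u(3) by (simp add: lookup_add lookup_scaleR_point sum.distrib sum_distrib_left)
    show ?thesis unfolding netflow_def sums by (simp add: algebra_simps)
  qed
  have sums: "sum (?f y) (sublevel n ?s m) = (\<Sum>k \<in> sublevel n ?s m. ?h k - ?h (?s k)) \<and>
      sum (?f z) (sublevel n ?s m) = (\<Sum>k \<in> sublevel n ?s m. ?h k - ?h (?s k))"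
    if m: "m \<le> n" for m
  proof -
    let ?A = "sublevel n ?s m"
    let ?B = "\<Sum>k \<in> ?A. ?h k - ?h (?s k)"
    have le: "sum (?f y) ?A \<le> ?B" "sum (?f z) ?A \<le> ?B"
      using y z m inv by (auto intro!: sum_netflow_sublevel_le lookup_in_hook_polytope)
    have "?B = sum (?f ?T) ?A"
      using flow.netflow[OF props(2)] sublevel_subset[of n ?s m] by (intro sum.cong) auto
    also have "\<dots> = (1 - u) * sum (?f y) ?A + u * sum (?f z) ?A"
      by (simp add: lin sum.distrib sum_distrib_left)
    \<comment> \<open>Two nonnegative slacks with positive weights add up to zero, so both
      vanish.\<close>
    finally have "(1 - u) * (?B - sum (?f y) ?A) + u * (?B - sum (?f z) ?A) = 0"
      by (simp add: algebra_simps)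
    moreover have "0 \<le> (1 - u) * (?B - sum (?f y) ?A)" "0 \<le> u * (?B - sum (?f z) ?A)"
      using le u by simp_all
    ultimately have "(1 - u) * (?B - sum (?f y) ?A) = 0" "u * (?B - sum (?f z) ?A) = 0"
      by linarith+
    then show ?thesis using u by simp
  qed
  have "?f y k = ?h k - ?h (?s k)" if "k \<in> {1..n}" for k
    by (rule eq_on_if_sums_sublevel_eq[OF inv that]) (rule sums[THEN conjunct1])
  moreover have "?f z k = ?h k - ?h (?s k)" if "k \<in> {1..n}" for k
    by (rule eq_on_if_sums_sublevel_eq[OF inv that]) (rule sums[THEN conjunct2])
  ultimately have "flow n ?h (Poly_Mapping.lookup y) ?s" "flow n ?h (Poly_Mapping.lookup z) ?s"
    using flow_lookup[OF y inv] flow_lookup[OF z inv] by blast+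
  then have "y = z" using segment_point_eqI[OF y] segment_point_eqI[OF z] by metis
  with \<open>y \<noteq> z\<close> show False by contradiction
qed

text \<open>Intersecting intervals takes the larger left end and the smaller right end. One-point
  intersections are excluded on both sides, since \<open>segs F\<close> has no singletons for
  \<open>F \<subseteq> pairs n\<close>.\<close>

lemma Rp_eq: "Rp n = segs ` {F. F \<subseteq> pairs n \<and> inter_closed F}"
proof -
  have mem: "segs F \<in> Rp n \<longleftrightarrow> inter_closed F" if F: "F \<subseteq> pairs n" for F
  proof -
    have "segs F \<subseteq> segments n" using F by (fastforce simp: segs_def segments_def pairs_def)
    then have "segs F \<in> Rp n \<longleftrightarrow> (\<forall>p \<in> F. \<forall>q \<in> F. {fst p..snd p} \<inter> {fst q..snd q} \<noteq> {} \<longrightarrow>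
        {fst p..snd p} \<inter> {fst q..snd q} \<in> segs F)"
      by (simp add: Rp_def segs_def case_prod_beta)
    also have "\<dots> \<longleftrightarrow> (\<forall>p \<in> F. \<forall>q \<in> F. max (fst p) (fst q) \<le> min (snd p) (snd q) \<longrightarrow>
        {max (fst p) (fst q)..min (snd p) (snd q)} \<in> segs F)"
      by (simp only: Int_atLeastAtMost atLeastatMost_empty_iff2 sup_max inf_min not_not
          atLeastatMost_empty_iff)
    also have "\<dots> \<longleftrightarrow> (\<forall>p \<in> F. \<forall>q \<in> F. max (fst p) (fst q) \<le> min (snd p) (snd q) \<longrightarrow>
        (max (fst p) (fst q), min (snd p) (snd q)) \<in> F)"
      using mem_segs_iff by blast
    also have "\<dots> \<longleftrightarrow> inter_closed F"
      by (simp only: inter_closed_def Ball_def split_paired_All fst_conv snd_conv) blast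
    finally show ?thesis .
  qed
  have "\<exists>F. F \<subseteq> pairs n \<and> E = segs F" if "E \<in> Rp n" for E
  proof (intro exI conjI)
    let ?F = "{(i, j) \<in> pairs n. {i..j} \<in> E}"
    show "?F \<subseteq> pairs n" by auto
    have "E \<subseteq> segments n" using that by (simp add: Rp_def)
    then show "E = segs ?F"
      by (fastforce simp: segs_def segments_def pairs_def)
  qed
  then show ?thesis using mem by blast
qed

theorem theorem1p2:
  fixes n :: nat and a :: "nat \<Rightarrow> nat"
  assumes "n \<ge> 2"
  shows "(\<forall>w. w permutes {1..n} \<longrightarrow> extremal_point n a w extreme_point_of FFLV_polytope n a) \<and>
    {extremal_point n a w | w. w permutes {1..n}} = {segment_point n a E | E. E \<in> Rp n}"
proof (intro conjI allI impI)
  show "extremal_point n a w extreme_point_of FFLV_polytope n a" if "w permutes {1..n}" for w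
    using that by (rule extreme_point_extremal_point)
  have "\<exists>E \<in> Rp n. extremal_point n a w = segment_point n a E" if w: "w permutes {1..n}" for w
    using extremal_point_props(3)[OF w] inter_closed_seg[OF permutes_inv[OF w]]
      seg_subset_pairs[of n "inv w"] unfolding Rp_eq by blast
  moreover have "\<exists>w. w permutes {1..n} \<and> segment_point n a E = extremal_point n a w"
    if "E \<in> Rp n" for E
  proof -
    from that obtain F where F: "F \<subseteq> pairs n" "inter_closed F" "E = segs F"
      unfolding Rp_eq by blast
    from ex_seg[OF F(1,2)] obtain s where s: "s permutes {1..n}" "seg n s = F" by blast
    \<comment> \<open>\<open>extremal_point_props\<close> describes the point of \<open>w\<close>
      through \<open>inv w\<close>, so \<open>w = inv s\<close> is the right choice.\<close>
    then have "segment_point n a E = extremal_point n a (inv s)"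
      using extremal_point_props(3)[OF permutes_inv[OF s(1)]] permutes_inv_inv[OF s(1)] F(3) by simp
    then show ?thesis using permutes_inv[OF s(1)] by blast
  qed
  ultimately show "{extremal_point n a w | w. w permutes {1..n}} =
    {segment_point n a E | E. E \<in> Rp n}" by blast
qed

end
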